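(* Let $N\ge 1$, $T\ge 1$, let $\pi$ be the Feynman--Kac distribution on $\mathsf{X}^T$ with components $(M_{1:T},G_{1:T})$, and let $r^{(p,n)}$ be a valid conditional resampling scheme. Then the Markov update $(X^*_{1:T},B_{1:T})\mapsto(\tilde X^*_{1:T},\tilde B_{1:T})$ on $\mathsf{X}^T\times[N]^T$ defined by the conditional particle filter with ancestor tracing (CPF-AT), run with $r^{(p,n)}$, is reversible with respect to $\pi\times\mathcal{U}([N]^T)$, where $\mathcal{U}([N]^T)$ is the uniform distribution on $[N]^T$.
   Context: Notation. $\mathsf{X}$ is a general measurable state space with a $\sigma$-finite dominating measure $\mathrm{d}x$; $[N]=\{1,\dots,N\}$ (counting measure); product spaces carry product measures; all functions are measurable. $x_{a:b}=(x_a,\dots,x_b)$, $y^{(1:N)}=(y^{(1)},\dots,y^{(N)})$, $y^{(-n)}$ is $y^{(1:N)}$ with the $n$th entry removed, $z_{a:b}^{(j_{a:b})}=(z_a^{(j_a)},\dots,z_b^{(j_b)})$. $\mathrm{Categ}(g^{(1:N)})$ is the distribution on $[N]$ with probabilities proportional to $g^{(1:N)}$. Feynman--Kac distribution. $M_1(x_1)$ is a probability density on $\mathsf{X}$; $M_k(x_k\mid x_{k-1})$, $2\le k\le T$, are transition probability densities; $G_1:\mathsf{X}\to[0,\infty)$ and $G_k:\mathsf{X}^2\to[0,\infty)$, $k\ge2$, are potentials. $\pi$ has density $\pi(x_{1:T})=\mathcal{Z}^{-1}M_1(x_1)G_1(x_1)\prod_{k=2}^T M_k(x_k\mid x_{k-1})G_k(x_{k-1},x_k)$,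 with normalising constant $\mathcal{Z}\in(0,\infty)$. Resampling. A resampling scheme $r(\cdot\mid g^{(1:N)})$ is a family of probability distributions on $[N]^N$ (depending measurably on $g^{(1:N)}\in[0,\infty)^N$). A family $r^{(p,n)}(\cdot\mid g^{(1:N)})$, $p,n\in[N]$, of distributions on $[N]^N$ is a valid conditional resampling scheme if there is a resampling scheme $r$ such that for all $g^{(1:N)}\ge0$ with $\sum_\ell g^{(\ell)}>0$ and all $p,n\in[N]$: (i) $\mathbb{P}(A^{(n)}=p)=1$ when $A^{(1:N)}\sim r^{(p,n)}(\cdot\mid g^{(1:N)})$; (ii) if $g^{(p)}>0$, then for all $a^{(1:N)}$ with $a^{(n)}=p$, $r^{(p,n)}(a^{(1:N)}\mid g^{(1:N)})=\mathbb{P}(A^{(-n)}=a^{(-n)}\mid A^{(n)}=p)$ when $A^{(1:N)}\sim r(\cdot\mid g^{(1:N)})$; (iii) $\mathbb{P}(A^{(n)}=p)=g^{(p)}/\sum_{i=1}^N g^{(i)}$ when $A^{(1:N)}\sim r(\cdot\mid g^{(1:N)})$. Algorithm CPF-AT. Input: reference path $X^*_{1:T}\in\mathsf{X}^T$ and reference indices $B_{1:T}\in[N]^T$. 1. Draw $X_1^{(i)}\sim M_1$ independently for $i\ne B_1$, set $X_1^{(B_1)}=X_1^*$, and $\mathbf{X}_1^{(i)}=X_1^{(i)}$ for $i\in[N]$. 2. For $k=1,\dots,T-1$: draw $A_k^{(1:N)}\sim r^{(B_k,B_{k+1})}\big(\cdot\mid G_k(\mathbf{X}_k^{(1)}),\dots,G_k(\mathbf{X}_k^{(N)})\big)$;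 draw $X_{k+1}^{(i)}\sim M_{k+1}(\cdot\mid X_k^{(A_k^{(i)})})$ independently for $i\ne B_{k+1}$ and set $X_{k+1}^{(B_{k+1})}=X_{k+1}^*$; set $\mathbf{X}_{k+1}^{(i)}=(X_k^{(A_k^{(i)})},X_{k+1}^{(i)})$ for $i\in[N]$. 3. Draw $\tilde B_T\sim\mathrm{Categ}\big(G_T(\mathbf{X}_T^{(1)}),\dots,G_T(\mathbf{X}_T^{(N)})\big)$. 4. Ancestor tracing: for $k=T-1,\dots,1$ set $\tilde B_k=A_k^{(\tilde B_{k+1})}$. 5. Output $(\tilde X^*_{1:T},\tilde B_{1:T})$ with $\tilde X^*_{1:T}=X_{1:T}^{(\tilde B_{1:T})}$. Resampling and categorical draws with all weights zero, or conditional resampling with reference weight zero, may be defined arbitrarily (they have probability zero when the input is distributed as $\pi\times\mathcal{U}([N]^T)$). *)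

theory Defs
  imports "HOL-Probability.Probability"
begin

section \<open>Reversible Markov kernels\<close>

definition reversible_kernel :: "'s measure \<Rightarrow> ('s \<Rightarrow> 's measure) \<Rightarrow> bool" where
  "reversible_kernel \<mu> K \<longleftrightarrow>
     K \<in> \<mu> \<rightarrow>\<^sub>M prob_algebra \<mu> \<and>
     (\<forall>A\<in>sets \<mu>. \<forall>B\<in>sets \<mu>.
        (\<integral>\<^sup>+s\<in>A. emeasure (K s) B \<partial>\<mu>) = (\<integral>\<^sup>+s\<in>B. emeasure (K s) A \<partial>\<mu>))"


section \<open>Feynman--Kac distributions\<close>

abbreviation nonneg_borel :: "real measure" where
  "nonneg_borel \<equiv> restrict_space borel {0..}"

text \<open>
  Times run over \<open>1, \<dots>, T\<close>.  The arguments of \<open>M k\<close> and \<open>G k\<close>, which are used for \<open>2 \<le> k \<le> T\<close>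
  only, are in chronological order: \<open>M k x y\<close> is the transition density from \<open>x\<close> to \<open>y\<close>.
\<close>

definition fk_unnormalised ::
  "nat \<Rightarrow> ('a \<Rightarrow> real) \<Rightarrow> (nat \<Rightarrow> 'a \<Rightarrow> 'a \<Rightarrow> real) \<Rightarrow> ('a \<Rightarrow> real) \<Rightarrow> (nat \<Rightarrow> 'a \<Rightarrow> 'a \<Rightarrow> real)
     \<Rightarrow> (nat \<Rightarrow> 'a) \<Rightarrow> real" where
  "fk_unnormalised T M1 M G1 G x =
     M1 (x 1) * G1 (x 1) * (\<Prod>k=2..T. M k (x (k - 1)) (x k) * G k (x (k - 1)) (x k))"

definition fk_const ::
  "'a measure \<Rightarrow> nat \<Rightarrow> ('a \<Rightarrow> real) \<Rightarrow> (nat \<Rightarrow> 'a \<Rightarrow> 'a \<Rightarrow> real) \<Rightarrow> ('a \<Rightarrow> real)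
     \<Rightarrow> (nat \<Rightarrow> 'a \<Rightarrow> 'a \<Rightarrow> real) \<Rightarrow> ennreal" where
  "fk_const X T M1 M G1 G =
     (\<integral>\<^sup>+x. ennreal (fk_unnormalised T M1 M G1 G x) \<partial>(\<Pi>\<^sub>M k\<in>{1..T}. X))"

definition fk_distr ::
  "'a measure \<Rightarrow> nat \<Rightarrow> ('a \<Rightarrow> real) \<Rightarrow> (nat \<Rightarrow> 'a \<Rightarrow> 'a \<Rightarrow> real) \<Rightarrow> ('a \<Rightarrow> real)
     \<Rightarrow> (nat \<Rightarrow> 'a \<Rightarrow> 'a \<Rightarrow> real) \<Rightarrow> (nat \<Rightarrow> 'a) measure" where
  "fk_distr X T M1 M G1 G =
     density (\<Pi>\<^sub>M k\<in>{1..T}. X)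
       (\<lambda>x. ennreal (fk_unnormalised T M1 M G1 G x) / fk_const X T M1 M G1 G)"

locale feynman_kac = sigma_finite_measure X
  for X :: "'a measure" +
  fixes T :: nat
    and M1 :: "'a \<Rightarrow> real" and M :: "nat \<Rightarrow> 'a \<Rightarrow> 'a \<Rightarrow> real"
    and G1 :: "'a \<Rightarrow> real" and G :: "nat \<Rightarrow> 'a \<Rightarrow> 'a \<Rightarrow> real"
  assumes T_ge_1: "T \<ge> 1"
    and M1_measurable: "M1 \<in> X \<rightarrow>\<^sub>M nonneg_borel"
    and M1_density: "(\<integral>\<^sup>+x. ennreal (M1 x) \<partial>X) = 1"
    and M_measurable: "\<And>k. k \<in> {2..T} \<Longrightarrow> (\<lambda>(x, y). M k x y) \<in> X \<Otimes>\<^sub>M X \<rightarrow>\<^sub>M nonneg_borel"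
    and M_density: "\<And>k x. k \<in> {2..T} \<Longrightarrow> x \<in> space X \<Longrightarrow> (\<integral>\<^sup>+y. ennreal (M k x y) \<partial>X) = 1"
    and G1_measurable: "G1 \<in> X \<rightarrow>\<^sub>M nonneg_borel"
    and G_measurable: "\<And>k. k \<in> {2..T} \<Longrightarrow> (\<lambda>(x, y). G k x y) \<in> X \<Otimes>\<^sub>M X \<rightarrow>\<^sub>M nonneg_borel"
    and const_pos: "0 < fk_const X T M1 M G1 G"
    and const_finite: "fk_const X T M1 M G1 G < \<infinity>"


section \<open>Resampling\<close>

definition weight_space :: "nat \<Rightarrow> (nat \<Rightarrow> real) measure" where
  "weight_space N = (\<Pi>\<^sub>M i\<in>{1..N}. nonneg_borel)"

definition index_vectors :: "nat \<Rightarrow> (nat \<Rightarrow> nat) measure" where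
  "index_vectors N = count_space ({1..N} \<rightarrow>\<^sub>E {1..N})"

definition resampling_scheme :: "nat \<Rightarrow> ((nat \<Rightarrow> real) \<Rightarrow> (nat \<Rightarrow> nat) measure) \<Rightarrow> bool" where
  "resampling_scheme N r \<longleftrightarrow> r \<in> weight_space N \<rightarrow>\<^sub>M prob_algebra (index_vectors N)"

definition valid_conditional_resampling ::
  "nat \<Rightarrow> (nat \<Rightarrow> nat \<Rightarrow> (nat \<Rightarrow> real) \<Rightarrow> (nat \<Rightarrow> nat) measure) \<Rightarrow> bool" where
  "valid_conditional_resampling N rc \<longleftrightarrow>
     (\<forall>p\<in>{1..N}. \<forall>n\<in>{1..N}. resampling_scheme N (rc p n)) \<and>
     (\<exists>r. resampling_scheme N r \<and>
       (\<forall>g\<in>space (weight_space N). (\<Sum>l=1..N. g l) > 0 \<longrightarrow>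
         (\<forall>p\<in>{1..N}. \<forall>n\<in>{1..N}.
           \<P>(A in rc p n g. A n = p) = 1 \<and>
           (g p > 0 \<longrightarrow>
             (\<forall>a\<in>{1..N} \<rightarrow>\<^sub>E {1..N}. a n = p \<longrightarrow>
               measure (rc p n g) {a} = \<P>(A in r g. (\<forall>i\<in>{1..N} - {n}. A i = a i) \<bar> A n = p))) \<and>
           \<P>(A in r g. A n = p) = g p / (\<Sum>i=1..N. g i))))"

text \<open>
  Draws that the algorithm may define arbitrarily: \<open>rd\<close> replaces conditional resampling when the
  reference weight is zero (in particular when all weights are), and \<open>d\<close> replaces the categorical
  distribution when all weights are zero.
\<close>

definition cond_resample ::
  "(nat \<Rightarrow> nat \<Rightarrow> (nat \<Rightarrow> real) \<Rightarrow> (nat \<Rightarrow> nat) measure)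
     \<Rightarrow> (nat \<Rightarrow> nat \<Rightarrow> (nat \<Rightarrow> real) \<Rightarrow> (nat \<Rightarrow> nat) measure)
     \<Rightarrow> nat \<Rightarrow> nat \<Rightarrow> (nat \<Rightarrow> real) \<Rightarrow> (nat \<Rightarrow> nat) measure" where
  "cond_resample rc rd p n g = (if g p > 0 then rc p n g else rd p n g)"

definition categorical :: "nat \<Rightarrow> nat measure \<Rightarrow> (nat \<Rightarrow> real) \<Rightarrow> nat measure" where
  "categorical N d g =
     (if (\<Sum>i=1..N. g i) > 0
      then point_measure {1..N} (\<lambda>i. ennreal (g i / (\<Sum>j=1..N. g j)))
      else d)"


section \<open>The conditional particle filter with ancestor tracing\<close>

definition path_space :: "'a measure \<Rightarrow> nat \<Rightarrow> nat \<Rightarrow> ((nat \<Rightarrow> 'a) \<times> (nat \<Rightarrow> nat)) measure" where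
  "path_space X N T = (\<Pi>\<^sub>M k\<in>{1..T}. X) \<Otimes>\<^sub>M count_space ({1..T} \<rightarrow>\<^sub>E {1..N})"

text \<open>
  Particle systems after \<open>m\<close> resampling steps: pairs \<open>(x, a)\<close> with \<open>x k i\<close> the \<open>i\<close>th particle at
  time \<open>k \<in> {1..m + 1}\<close> and \<open>a k i\<close> the ancestor, at time \<open>k \<in> {1..m}\<close>, of the \<open>i\<close>th particle at
  time \<open>k + 1\<close>.
\<close>

definition history_space ::
  "'a measure \<Rightarrow> nat \<Rightarrow> nat \<Rightarrow> ((nat \<Rightarrow> nat \<Rightarrow> 'a) \<times> (nat \<Rightarrow> nat \<Rightarrow> nat)) measure" where
  "history_space X N m =
     (\<Pi>\<^sub>M k\<in>{1..Suc m}. \<Pi>\<^sub>M i\<in>{1..N}. X) \<Otimes>\<^sub>M (\<Pi>\<^sub>M k\<in>{1..m}. index_vectors N)"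

definition weights ::
  "nat \<Rightarrow> ('a \<Rightarrow> real) \<Rightarrow> (nat \<Rightarrow> 'a \<Rightarrow> 'a \<Rightarrow> real) \<Rightarrow> nat
     \<Rightarrow> (nat \<Rightarrow> nat \<Rightarrow> 'a) \<Rightarrow> (nat \<Rightarrow> nat \<Rightarrow> nat) \<Rightarrow> nat \<Rightarrow> real" where
  "weights N G1 G k x a =
     (\<lambda>i\<in>{1..N}. if k = 1 then G1 (x 1 i) else G k (x (k - 1) (a (k - 1) i)) (x k i))"

text \<open>
  Independent draws with densities \<open>D i\<close>, except that the particle with index \<open>b\<close> is set to \<open>y\<close>.
\<close>

definition draw_particles ::
  "'a measure \<Rightarrow> nat \<Rightarrow> nat \<Rightarrow> 'a \<Rightarrow> (nat \<Rightarrow> 'a \<Rightarrow> real) \<Rightarrow> (nat \<Rightarrow> 'a) measure" where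
  "draw_particles X N b y D =
     (\<Pi>\<^sub>M i\<in>{1..N}. if i = b then return X y else density X (\<lambda>z. ennreal (D i z)))"

primrec cpf_forward ::
  "'a measure \<Rightarrow> nat \<Rightarrow> ('a \<Rightarrow> real) \<Rightarrow> (nat \<Rightarrow> 'a \<Rightarrow> 'a \<Rightarrow> real) \<Rightarrow> ('a \<Rightarrow> real)
     \<Rightarrow> (nat \<Rightarrow> 'a \<Rightarrow> 'a \<Rightarrow> real)
     \<Rightarrow> (nat \<Rightarrow> nat \<Rightarrow> (nat \<Rightarrow> real) \<Rightarrow> (nat \<Rightarrow> nat) measure)
     \<Rightarrow> (nat \<Rightarrow> 'a) \<Rightarrow> (nat \<Rightarrow> nat) \<Rightarrow> nat
     \<Rightarrow> ((nat \<Rightarrow> nat \<Rightarrow> 'a) \<times> (nat \<Rightarrow> nat \<Rightarrow> nat)) measure" where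
  "cpf_forward X N M1 M G1 G q xs b 0 =
     do {
       x1 \<leftarrow> draw_particles X N (b 1) (xs 1) (\<lambda>i. M1);
       return (history_space X N 0) ((\<lambda>k. undefined)(1 := x1), (\<lambda>k. undefined))
     }"
| "cpf_forward X N M1 M G1 G q xs b (Suc m) =
     (let k = Suc m in
      do {
        (x, a) \<leftarrow> cpf_forward X N M1 M G1 G q xs b m;
        A \<leftarrow> q (b k) (b (k + 1)) (weights N G1 G k x a);
        x' \<leftarrow> draw_particles X N (b (k + 1)) (xs (k + 1)) (\<lambda>i. M (k + 1) (x k (A i)));
        return (history_space X N (Suc m)) (x(k + 1 := x'), a(k := A))
      })"

text \<open>\<open>trace_back a T j m\<close> is the ancestor index at time \<open>T - m\<close> of particle \<open>j\<close> at time \<open>T\<close>.\<close>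

primrec trace_back :: "(nat \<Rightarrow> nat \<Rightarrow> nat) \<Rightarrow> nat \<Rightarrow> nat \<Rightarrow> nat \<Rightarrow> nat" where
  "trace_back a T j 0 = j"
| "trace_back a T j (Suc m) = a (T - Suc m) (trace_back a T j m)"

definition cpf_at ::
  "'a measure \<Rightarrow> nat \<Rightarrow> nat \<Rightarrow> ('a \<Rightarrow> real) \<Rightarrow> (nat \<Rightarrow> 'a \<Rightarrow> 'a \<Rightarrow> real) \<Rightarrow> ('a \<Rightarrow> real)
     \<Rightarrow> (nat \<Rightarrow> 'a \<Rightarrow> 'a \<Rightarrow> real)
     \<Rightarrow> (nat \<Rightarrow> nat \<Rightarrow> (nat \<Rightarrow> real) \<Rightarrow> (nat \<Rightarrow> nat) measure)
     \<Rightarrow> (nat \<Rightarrow> nat \<Rightarrow> (nat \<Rightarrow> real) \<Rightarrow> (nat \<Rightarrow> nat) measure)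
     \<Rightarrow> nat measure
     \<Rightarrow> (nat \<Rightarrow> 'a) \<times> (nat \<Rightarrow> nat) \<Rightarrow> ((nat \<Rightarrow> 'a) \<times> (nat \<Rightarrow> nat)) measure" where
  "cpf_at X N T M1 M G1 G rc rd d = (\<lambda>(xs, b).
     do {
       (x, a) \<leftarrow> cpf_forward X N M1 M G1 G (cond_resample rc rd) xs b (T - 1);
       bT \<leftarrow> categorical N d (weights N G1 G T x a);
       let b' = (\<lambda>k\<in>{1..T}. trace_back a T bT (T - k));
       return (path_space X N T) (\<lambda>k\<in>{1..T}. x k (b' k), b')
     })"

end

theory Submission
  imports Defs
begin

text \<open>
  Choosing a reference index with probability proportional to its weight and then resampling
  conditionally on it amounts to unconditional resampling.  Hence, under the unnormalised
  predictive law of \<open>(X\<^sup>*, B)\<close>, the particle history produced by the forward pass is distributed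
  like the history of the unconditional particle filter, reweighted by the total weight at each
  resampling step, together with a uniformly counted lineage \<open>(X\<^sup>*, B)\<close> of it
  (\<open>forward_particle_integral\<close>).  With the last potential included, the reference lineage is
  therefore drawn from the history with probability proportional to its final weight, which is
  also how the output lineage is drawn.  Given the history, input and output are thus exchangeable,
  which is reversibility.
\<close>

section \<open>Kernels and finite products\<close>

text \<open>Two cancellations carry the induction over time. Conditions (ii) and (iii) are a Bayes
  formula: \<open>g p\<close> times the conditional probability of \<open>a\<close> is the total
  weight times its unconditional probability if \<open>a n = p\<close>, and 0 otherwise. The factor
  \<open>g p\<close> comes from the Feynman-Kac density and the sum over \<open>p\<close> from the
  uniform reference indices, so path and indices have to be integrated together. Likewise the factor
  \<open>M\<close> of the density redraws the pinned particle, after which all \<open>N\<close>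
  particles are independent draws. Where the algorithm is free (reference weight zero, or all
  weights zero) the density supplies a zero factor, so \<open>rd\<close> and \<open>d\<close> drop
  out. The obstacle is that conditional resampling at one time already depends on the reference
  index at the next. The induction therefore runs on densities that stop just before the last
  potential: that potential is the weight still to be paired with the next resampling step or, at
  the end, with the categorical draw. The test functional depends on path, indices and history at
  once, since each step of the induction produces such a functional.\<close>

lemma measurable_PiM_kernel:
  assumes I: "finite I"
    and K: "\<And>i. i \<in> I \<Longrightarrow> K i \<in> S \<rightarrow>\<^sub>M prob_algebra (L i)"
  shows "(\<lambda>s. \<Pi>\<^sub>M i\<in>I. K i s) \<in> S \<rightarrow>\<^sub>M prob_algebra (\<Pi>\<^sub>M i\<in>I. L i)"
proof (rule measurable_prob_algebra_generated[OF sets_PiM Int_stable_prod_algebra prod_algebra_sets_into_space])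
  fix s assume s: "s \<in> space S"
  have K_s: "sets (K i s) = sets (L i)" "prob_space (K i s)" if "i \<in> I" for i
    using measurable_space[OF K[OF that] s] by (auto simp: space_prob_algebra)
  show "prob_space (\<Pi>\<^sub>M i\<in>I. K i s)" "sets (\<Pi>\<^sub>M i\<in>I. K i s) = sets (\<Pi>\<^sub>M i\<in>I. L i)"
    using K_s by (auto intro!: prob_space_PiM sets_PiM_cong)
next
  fix A assume "A \<in> prod_algebra I L"
  then obtain E where A: "A = Pi\<^sub>E I E" and "E \<in> (\<Pi> i\<in>I. sets (L i))"
    unfolding prod_algebra_eq_finite[OF I] by auto
  then have E: "E i \<in> sets (L i)" if "i \<in> I" for i
    using that by auto
  have "emeasure (\<Pi>\<^sub>M i\<in>I. K i s) A = (\<Prod>i\<in>I. emeasure (K i s) (E i))" if s: "s \<in> space S" for s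
  proof -
    \<comment> \<open>\<open>product_sigma_finite\<close> constrains every index, so coordinates
      outside \<open>I\<close> get a dummy probability measure, which the product over
      \<open>I\<close> does not see.\<close>
    let ?K = "\<lambda>i. if i \<in> I then K i s else count_space {undefined}"
    have K_s: "sets (K i s) = sets (L i)" "prob_space (K i s)" if "i \<in> I" for i
      using measurable_space[OF K[OF that] s] by (auto simp: space_prob_algebra)
    interpret K: prob_space "?K i" for i
      using K_s by (cases "i \<in> I") (auto intro!: prob_spaceI)
    interpret product_sigma_finite ?K ..
    have "emeasure (\<Pi>\<^sub>M i\<in>I. K i s) A = emeasure (\<Pi>\<^sub>M i\<in>I. ?K i) (Pi\<^sub>E I E)"
      unfolding A by (intro arg_cong2[where f=emeasure] PiM_cong) auto
    also have "\<dots> = (\<Prod>i\<in>I. emeasure (?K i) (E i))"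
      using I E K_s by (intro emeasure_PiM) auto
    finally show ?thesis by simp
  qed
  moreover have "(\<lambda>s. \<Prod>i\<in>I. emeasure (K i s) (E i)) \<in> borel_measurable S"
    using measurable_prob_algebraD[OF K] E
    by (intro borel_measurable_prod_ennreal measurable_emeasure_kernel) auto
  ultimately show "(\<lambda>s. emeasure (\<Pi>\<^sub>M i\<in>I. K i s) A) \<in> borel_measurable S"
    by (simp cong: measurable_cong)
qed

lemma prob_space_density_iff:
  assumes "f \<in> borel_measurable X"
  shows "prob_space (density X f) \<longleftrightarrow> (\<integral>\<^sup>+x. f x \<partial>X) = 1"
proof -
  have "emeasure (density X f) (space (density X f)) = (\<integral>\<^sup>+x. f x \<partial>X)"
    using assms by (subst emeasure_density) (auto cong: nn_integral_cong)
  then show ?thesis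
    by (auto intro: prob_spaceI dest: prob_space.emeasure_space_1)
qed

lemma (in sigma_finite_measure) measurable_density_kernel:
  assumes D[measurable]: "(\<lambda>(s, z). D s z) \<in> borel_measurable (S \<Otimes>\<^sub>M M)"
    and D1: "\<And>s. s \<in> space S \<Longrightarrow> (\<integral>\<^sup>+z. D s z \<partial>M) = 1"
  shows "(\<lambda>s. density M (D s)) \<in> S \<rightarrow>\<^sub>M prob_algebra M"
proof (rule measurable_prob_algebra_generated[OF sets.sigma_sets_eq[symmetric] sets.Int_stable sets.space_closed])
  fix s assume s: "s \<in> space S"
  then show "prob_space (density M (D s))"
    using D1 by (subst prob_space_density_iff) auto
next
  fix A assume [measurable]: "A \<in> sets M"
  have "(\<lambda>s. \<integral>\<^sup>+z. D s z * indicator A z \<partial>M) \<in> borel_measurable S"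
    by measurable
  then show "(\<lambda>s. emeasure (density M (D s)) A) \<in> borel_measurable S"
    by (rule measurable_cong[THEN iffD1, rotated]) (auto simp: emeasure_density)
qed auto

lemma (in sigma_finite_measure) measurable_draw_particles:
  assumes [measurable]: "y \<in> S \<rightarrow>\<^sub>M M"
    and D: "\<And>i. i \<in> {1..N} \<Longrightarrow> (\<lambda>(s, z). D s i z) \<in> borel_measurable (S \<Otimes>\<^sub>M M)"
    and D1: "\<And>i s. i \<in> {1..N} \<Longrightarrow> s \<in> space S \<Longrightarrow> (\<integral>\<^sup>+z. ennreal (D s i z) \<partial>M) = 1"
  shows "(\<lambda>s. draw_particles M N n (y s) (D s)) \<in> S \<rightarrow>\<^sub>M prob_algebra (\<Pi>\<^sub>M i\<in>{1..N}. M)"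
  unfolding draw_particles_def
proof (rule measurable_PiM_kernel)
  fix i assume i: "i \<in> {1..N}"
  note [measurable] = D[OF i]
  have "(\<lambda>s. density M (\<lambda>z. ennreal (D s i z))) \<in> S \<rightarrow>\<^sub>M prob_algebra M"
    using D1[OF i] by (intro measurable_density_kernel) auto
  then show "(\<lambda>s. if i = n then return M (y s) else density M (\<lambda>z. ennreal (D s i z))) \<in> S \<rightarrow>\<^sub>M prob_algebra M"
    by (cases "i = n") auto
qed simp

lemma (in sigma_finite_measure) nn_integral_swap_kernel:
  assumes P: "P \<in> space (prob_algebra S)"
    and f: "(\<lambda>(y, h). f y h) \<in> borel_measurable (M \<Otimes>\<^sub>M S)"
  shows "(\<integral>\<^sup>+y. \<integral>\<^sup>+h. f y h \<partial>P \<partial>M) = (\<integral>\<^sup>+h. \<integral>\<^sup>+y. f y h \<partial>M \<partial>P)"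
proof -
  have [measurable_cong]: "sets P = sets S" and "prob_space P"
    using P by (auto simp: space_prob_algebra)
  interpret P: prob_space P by fact
  interpret pair_sigma_finite P M ..
  note f[measurable]
  show ?thesis
    by (rule Fubini') measurable
qed

lemma nn_integral_finite_sets:
  assumes "finite A" "sets Q = Pow A"
  shows "integral\<^sup>N Q f = (\<Sum>a\<in>A. emeasure Q {a} * f a)"
proof -
  have "Q = point_measure A (\<lambda>a. emeasure Q {a})"
    using assms by (intro measure_eqI_finite[of _ A])
      (auto simp: sets_point_measure emeasure_point_measure_finite)
  then have "integral\<^sup>N Q f = integral\<^sup>N (point_measure A (\<lambda>a. emeasure Q {a})) f"
    by simp
  also have "\<dots> = (\<Sum>a\<in>A. emeasure Q {a} * f a)"
    by (rule nn_integral_point_measure_finite[OF assms(1)])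
  finally show ?thesis .
qed

text \<open>Let the pinned value \<open>y\<close> be drawn from the density of the very coordinate
  where it is inserted. Then the point mass at \<open>y\<close> and that density together make an
  ordinary independent draw, and \<open>y\<close> can be read off as \<open>x n\<close>. This is how
  a reference particle ceases to be special.\<close>

lemma (in sigma_finite_measure) nn_integral_draw_particles:
  assumes n: "n \<in> {1..N}"
    and D[measurable]: "\<And>i. i \<in> {1..N} \<Longrightarrow> D i \<in> borel_measurable M"
    and D1: "\<And>i. i \<in> {1..N} \<Longrightarrow> (\<integral>\<^sup>+z. ennreal (D i z) \<partial>M) = 1"
    and f[measurable]: "(\<lambda>(y, x). f y x) \<in> borel_measurable (M \<Otimes>\<^sub>M (\<Pi>\<^sub>M i\<in>{1..N}. M))"
  shows "(\<integral>\<^sup>+y. ennreal (D n y) * (\<integral>\<^sup>+x. f y x \<partial>draw_particles M N n y D) \<partial>M) =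
    (\<integral>\<^sup>+x. f (x n) x \<partial>(\<Pi>\<^sub>M i\<in>{1..N}. density M (D i)))"
proof -
  define J where "J = {1..N} - {n}"
  have J: "finite J" "n \<notin> J" "{1..N} = insert n J"
    using n by (auto simp: J_def)
  \<comment> \<open>The density of coordinate \<open>n\<close> integrates to 1, which rules out an
    empty space; \<open>y0\<close> fills the coordinates outside \<open>{1..N}\<close>
    below.\<close>
  obtain y0 where "y0 \<in> space M"
    using D1[OF n] nn_integral_empty[of M] by fastforce
  \<comment> \<open>Coordinate \<open>n\<close> and all indices outside \<open>{1..N}\<close> carry
    the point mass at \<open>y\<close>: every factor is a probability measure, and the
    \<open>n\<close>th one is the pinned particle.\<close>
  define K where "K y i = (if i \<in> J then density M (D i) else return M y)" for y i
  have K: "product_sigma_finite (K y)" if "y \<in> space M" for y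
  proof -
    have "prob_space (K y i)" for i
      using that D1[of i] by (auto simp: K_def J_def prob_space_return prob_space_density_iff)
    then interpret prob_space "K y i" for i .
    show ?thesis ..
  qed
  have sets_K[measurable_cong, simp]: "sets (K y i) = sets M" for y i
    by (auto simp: K_def)
  have sets_K': "sets (\<Pi>\<^sub>M i\<in>insert n J. K y i) = sets (\<Pi>\<^sub>M i\<in>{1..N}. M)" for y
    unfolding J(3) by (intro sets_PiM_cong) auto
  note f' = f[unfolded J(3)]
  have inner: "(\<integral>\<^sup>+x. f y x \<partial>draw_particles M N n y D) = (\<integral>\<^sup>+x. f y (x(n := y)) \<partial>(\<Pi>\<^sub>M i\<in>J. density M (D i)))"
    if y: "y \<in> space M" for y
  proof -
    interpret product_sigma_finite "K y" by (rule K[OF y])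
    have fy: "f y \<in> borel_measurable (\<Pi>\<^sub>M i\<in>{1..N}. M)"
      using y by measurable
    have "draw_particles M N n y D = (\<Pi>\<^sub>M i\<in>insert n J. K y i)"
      unfolding draw_particles_def J(3) using J by (intro PiM_cong) (auto simp: K_def)
    then have "(\<integral>\<^sup>+x. f y x \<partial>draw_particles M N n y D) =
        (\<integral>\<^sup>+x. \<integral>\<^sup>+z. f y (x(n := z)) \<partial>K y n \<partial>(\<Pi>\<^sub>M i\<in>J. K y i))"
      using fy J by (simp add: product_nn_integral_insert measurable_cong_sets[OF sets_K' refl])
    also have "\<dots> = (\<integral>\<^sup>+x. f y (x(n := y)) \<partial>(\<Pi>\<^sub>M i\<in>J. K y i))"
    proof (rule nn_integral_cong)
      fix x assume x: "x \<in> space (\<Pi>\<^sub>M i\<in>J. K y i)"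
      then have "x \<in> space (\<Pi>\<^sub>M i\<in>J. M)"
        by (simp add: space_PiM sets_eq_imp_space_eq[OF sets_K])
      then have "(\<lambda>z. x(n := z)) \<in> M \<rightarrow>\<^sub>M (\<Pi>\<^sub>M i\<in>insert n J. M)"
        using J by (intro measurable_component_update) auto
      then have "(\<lambda>z. f y (x(n := z))) \<in> borel_measurable M"
        using fy unfolding J(3) by (rule measurable_compose)
      then show "(\<integral>\<^sup>+z. f y (x(n := z)) \<partial>K y n) = f y (x(n := y))"
        using y J by (simp add: K_def nn_integral_return)
    qed
    also have "(\<Pi>\<^sub>M i\<in>J. K y i) = (\<Pi>\<^sub>M i\<in>J. density M (D i))"
      by (intro PiM_cong) (auto simp: K_def)
    finally show ?thesis .
  qed
  define L where "L i = (if i \<in> {1..N} then density M (D i) else return M y0)" for i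
  have "prob_space (L i)" for i
    using \<open>y0 \<in> space M\<close> D1 by (auto simp: L_def prob_space_return prob_space_density_iff)
  then interpret L: prob_space "L i" for i .
  interpret product_sigma_finite L ..
  have sets_L[measurable_cong, simp]: "sets (L i) = sets M" for i
    by (auto simp: L_def)
  have sets_L': "sets (\<Pi>\<^sub>M i\<in>insert n J. L i) = sets (\<Pi>\<^sub>M i\<in>{1..N}. M)"
    unfolding J(3) by (intro sets_PiM_cong) auto
  have "(\<lambda>x. f (x n) x) \<in> borel_measurable (\<Pi>\<^sub>M i\<in>{1..N}. M)"
    using n by measurable
  then have "(\<integral>\<^sup>+x. f (x n) x \<partial>(\<Pi>\<^sub>M i\<in>insert n J. L i)) =
      (\<integral>\<^sup>+y. \<integral>\<^sup>+x. f y (x(n := y)) \<partial>(\<Pi>\<^sub>M i\<in>J. L i) \<partial>L n)"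
    using J by (subst product_nn_integral_insert_rev) (auto simp: measurable_cong_sets[OF sets_L' refl])
  also have "(\<Pi>\<^sub>M i\<in>insert n J. L i) = (\<Pi>\<^sub>M i\<in>{1..N}. density M (D i))"
    unfolding J(3) using J by (intro PiM_cong) (auto simp: L_def)
  also have L_J: "(\<Pi>\<^sub>M i\<in>J. L i) = (\<Pi>\<^sub>M i\<in>J. density M (D i))"
    using J by (intro PiM_cong) (auto simp: L_def)
  also have "L n = density M (D n)"
    using n by (simp add: L_def)
  also have "(\<integral>\<^sup>+y. \<integral>\<^sup>+x. f y (x(n := y)) \<partial>(\<Pi>\<^sub>M i\<in>J. density M (D i)) \<partial>density M (D n)) =
      (\<integral>\<^sup>+y. ennreal (D n y) * (\<integral>\<^sup>+x. f y (x(n := y)) \<partial>(\<Pi>\<^sub>M i\<in>J. density M (D i))) \<partial>M)"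
  proof (rule nn_integral_density)
    have "(\<lambda>(y, x). x(n := y)) \<in> M \<Otimes>\<^sub>M (\<Pi>\<^sub>M i\<in>J. M) \<rightarrow>\<^sub>M (\<Pi>\<^sub>M i\<in>insert n J. M)"
      by measurable
    then have [measurable]: "(\<lambda>(y, x). x(n := y)) \<in> M \<Otimes>\<^sub>M (\<Pi>\<^sub>M i\<in>J. M) \<rightarrow>\<^sub>M (\<Pi>\<^sub>M i\<in>{1..N}. M)"
      unfolding J(3) .
    \<comment> \<open>Written with the family \<open>L\<close>, the product over \<open>J\<close> is
      a probability space, which gives measurability of the integral in the parameter
      \<open>y\<close>.\<close>
    have "prob_space (\<Pi>\<^sub>M i\<in>J. L i)"
      by (intro prob_space_PiM) unfold_locales
    then interpret PJ: prob_space "\<Pi>\<^sub>M i\<in>J. L i" .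
    have "(\<lambda>y. \<integral>\<^sup>+x. f y (x(n := y)) \<partial>(\<Pi>\<^sub>M i\<in>J. L i)) \<in> borel_measurable M"
      by measurable
    then show "(\<lambda>y. \<integral>\<^sup>+x. f y (x(n := y)) \<partial>(\<Pi>\<^sub>M i\<in>J. density M (D i))) \<in> borel_measurable M"
      unfolding L_J .
  qed (use n in simp)
  also have "\<dots> = (\<integral>\<^sup>+y. ennreal (D n y) * (\<integral>\<^sup>+x. f y x \<partial>draw_particles M N n y D) \<partial>M)"
    by (intro nn_integral_cong) (simp add: inner)
  finally show ?thesis ..
qed

section \<open>Resampling\<close>

lemma weight_space_nonneg: "g \<in> space (weight_space N) \<Longrightarrow> i \<in> {1..N} \<Longrightarrow> 0 \<le> g i"
  by (auto simp: weight_space_def space_PiM space_restrict_space)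

lemma measurable_weight_component:
  assumes "i \<in> {1..N}"
  shows "(\<lambda>g. g i) \<in> borel_measurable (weight_space N)"
proof -
  have "(\<lambda>g. g i) \<in> weight_space N \<rightarrow>\<^sub>M nonneg_borel"
    unfolding weight_space_def using assms by (rule measurable_component_singleton)
  then show ?thesis
    by (simp add: measurable_restrict_space2_iff)
qed

lemma measurable_index_component:
  assumes "f \<in> S \<rightarrow>\<^sub>M index_vectors N" "i \<in> {1..N}"
  shows "(\<lambda>s. f s i) \<in> S \<rightarrow>\<^sub>M count_space {1..N}"
proof -
  have "(\<lambda>A. A i) \<in> index_vectors N \<rightarrow>\<^sub>M count_space {1..N}"
    unfolding index_vectors_def measurable_count_space_eq1 space_count_space
    using assms(2) by (intro Pi_I) (rule PiE_mem)
  with assms(1) show ?thesis by (rule measurable_compose)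
qed

lemma measurable_categorical:
  assumes d: "d \<in> space (prob_algebra (count_space {1..N}))"
  shows "categorical N d \<in> weight_space N \<rightarrow>\<^sub>M prob_algebra (count_space {1..N})"
proof (rule measurable_prob_algebra_generated[OF sets.sigma_sets_eq[symmetric] sets.Int_stable sets.space_closed])
  have d': "prob_space d" "sets d = Pow {1..N}"
    using d by (auto simp: space_prob_algebra)
  fix g assume g: "g \<in> space (weight_space N)"
  show "sets (categorical N d g) = sets (count_space {1..N})"
    using d' by (simp add: categorical_def sets_point_measure)
  show "prob_space (categorical N d g)"
  proof (cases "(\<Sum>i=1..N. g i) > 0")
    case True
    have "emeasure (categorical N d g) (space (categorical N d g)) = (\<Sum>i=1..N. ennreal (g i / (\<Sum>j=1..N. g j)))"
      using True by (simp add: categorical_def space_point_measure emeasure_point_measure_finite)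
    also have "\<dots> = ennreal (\<Sum>i=1..N. g i / (\<Sum>j=1..N. g j))"
      using True weight_space_nonneg[OF g] by (intro sum_ennreal) auto
    also have "(\<Sum>i=1..N. g i / (\<Sum>j=1..N. g j)) = 1"
      using True by (simp flip: sum_divide_distrib)
    finally show ?thesis
      by (intro prob_spaceI) simp
  qed (use d' in \<open>simp add: categorical_def\<close>)
next
  fix B assume B: "B \<in> sets (count_space {1..N})"
  then have BN: "i \<in> {1..N}" if "i \<in> B" for i using that by auto
  have *: "emeasure (categorical N d g) B =
      (if (\<Sum>i=1..N. g i) > 0 then \<Sum>i\<in>B. ennreal (g i / (\<Sum>j=1..N. g j)) else emeasure d B)" for g
    using B by (auto simp: categorical_def emeasure_point_measure_finite)
  note weight = measurable_weight_component
  have total[measurable]: "(\<lambda>g. \<Sum>i=1..N. g i) \<in> borel_measurable (weight_space N)"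
    by (intro borel_measurable_sum weight)
  have "(\<lambda>g. \<Sum>i\<in>B. ennreal (g i / (\<Sum>j=1..N. g j))) \<in> borel_measurable (weight_space N)"
    by (intro borel_measurable_sum measurable_compose[OF _ measurable_ennreal] borel_measurable_divide weight BN total)
  then show "(\<lambda>g. emeasure (categorical N d g) B) \<in> borel_measurable (weight_space N)"
    unfolding * using borel_measurable_less[OF borel_measurable_const total] by (intro measurable_If) simp_all
qed

lemma nn_integral_categorical:
  assumes "(\<Sum>i=1..N. g i) > 0"
  shows "(\<integral>\<^sup>+j. f j \<partial>categorical N d g) = (\<Sum>j=1..N. ennreal (g j / (\<Sum>i=1..N. g i)) * f j)"
  using assms by (simp add: categorical_def nn_integral_point_measure_finite)

lemma measurable_cond_resample:
  assumes "p \<in> {1..N}" "resampling_scheme N (rc p n)" "resampling_scheme N (rd p n)"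
  shows "cond_resample rc rd p n \<in> weight_space N \<rightarrow>\<^sub>M prob_algebra (index_vectors N)"
proof -
  note [measurable] = measurable_weight_component[OF assms(1)]
    assms(2,3)[unfolded resampling_scheme_def]
  show ?thesis
    unfolding cond_resample_def by measurable
qed

text \<open>A witness \<open>r\<close> of the existential in
  \<open>valid_conditional_resampling\<close> is fixed, because the unconditional filter that serves
  as common reference is built from it.\<close>

locale particle_filter = feynman_kac X T M1 M G1 G
  for X :: "'a measure" and T M1 M G1 G +
  fixes N :: nat and rc rd :: "nat \<Rightarrow> nat \<Rightarrow> (nat \<Rightarrow> real) \<Rightarrow> (nat \<Rightarrow> nat) measure"
    and r :: "(nat \<Rightarrow> real) \<Rightarrow> (nat \<Rightarrow> nat) measure"
  assumes rc_scheme: "\<And>p n. p \<in> {1..N} \<Longrightarrow> n \<in> {1..N} \<Longrightarrow> resampling_scheme N (rc p n)"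
    and rd_scheme: "\<And>p n. p \<in> {1..N} \<Longrightarrow> n \<in> {1..N} \<Longrightarrow> resampling_scheme N (rd p n)"
    and r_scheme: "resampling_scheme N r"
    and rc_reference: "\<And>g p n. g \<in> space (weight_space N) \<Longrightarrow> (\<Sum>l=1..N. g l) > 0 \<Longrightarrow>
      p \<in> {1..N} \<Longrightarrow> n \<in> {1..N} \<Longrightarrow> \<P>(A in rc p n g. A n = p) = 1"
    and rc_conditional: "\<And>g p n a. g \<in> space (weight_space N) \<Longrightarrow> (\<Sum>l=1..N. g l) > 0 \<Longrightarrow>
      p \<in> {1..N} \<Longrightarrow> n \<in> {1..N} \<Longrightarrow> g p > 0 \<Longrightarrow> a \<in> {1..N} \<rightarrow>\<^sub>E {1..N} \<Longrightarrow> a n = p \<Longrightarrow>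
      measure (rc p n g) {a} = \<P>(A in r g. (\<forall>i\<in>{1..N} - {n}. A i = a i) \<bar> A n = p)"
    and r_marginal: "\<And>g p n. g \<in> space (weight_space N) \<Longrightarrow> (\<Sum>l=1..N. g l) > 0 \<Longrightarrow>
      p \<in> {1..N} \<Longrightarrow> n \<in> {1..N} \<Longrightarrow> \<P>(A in r g. A n = p) = g p / (\<Sum>i=1..N. g i)"
begin

abbreviation q :: "nat \<Rightarrow> nat \<Rightarrow> (nat \<Rightarrow> real) \<Rightarrow> (nat \<Rightarrow> nat) measure" where
  "q \<equiv> cond_resample rc rd"

lemma measurable_q: "p \<in> {1..N} \<Longrightarrow> n \<in> {1..N} \<Longrightarrow> q p n \<in> weight_space N \<rightarrow>\<^sub>M prob_algebra (index_vectors N)"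
  by (intro measurable_cond_resample rc_scheme rd_scheme)

text \<open>Bayes' formula with the division removed: for a positive reference weight, (ii) and
  (iii) give the conditional probability of \<open>a\<close> as its probability under
  \<open>r\<close> times the total weight over \<open>g p\<close>. Multiplied out, the identity
  survives at \<open>g p = 0\<close>: then either all weights vanish, or (iii) makes every
  \<open>a\<close> with \<open>a n = p\<close> a null event of \<open>r\<close>, and whatever
  \<open>rd\<close> does is multiplied by zero.\<close>

lemma conditional_resampling_atom:
  assumes g: "g \<in> space (weight_space N)" and p: "p \<in> {1..N}" and n: "n \<in> {1..N}"
    and a: "a \<in> {1..N} \<rightarrow>\<^sub>E {1..N}"
  shows "ennreal (g p) * emeasure (q p n g) {a} =
    (if a n = p then ennreal (\<Sum>i=1..N. g i) * emeasure (r g) {a} else 0)"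
proof -
  let ?S = "\<Sum>i=1..N. g i"
  have g0: "\<And>i. i \<in> {1..N} \<Longrightarrow> 0 \<le> g i"
    using weight_space_nonneg[OF g] .
  then have "0 \<le> ?S" by (intro sum_nonneg)
  have "r g \<in> space (prob_algebra (index_vectors N))" "q p n g \<in> space (prob_algebra (index_vectors N))"
    using r_scheme measurable_q[OF p n] g by (auto simp: resampling_scheme_def dest: measurable_space)
  then have sets_r: "sets (r g) = Pow ({1..N} \<rightarrow>\<^sub>E {1..N})" "prob_space (r g)"
    and sets_q: "sets (q p n g) = Pow ({1..N} \<rightarrow>\<^sub>E {1..N})" "prob_space (q p n g)"
    by (auto simp: space_prob_algebra index_vectors_def)
  interpret r: prob_space "r g" by fact
  interpret q: prob_space "q p n g" by fact
  have space_r: "space (r g) = {1..N} \<rightarrow>\<^sub>E {1..N}" and space_q: "space (q p n g) = {1..N} \<rightarrow>\<^sub>E {1..N}"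
    using sets_r sets_q by (metis sets_count_space sets_eq_imp_space_eq space_count_space)+
  \<comment> \<open>An atom is no likelier than the event fixing only its \<open>n\<close>th entry;
    if that entry has weight zero, the atom is null.\<close>
  have r_le: "measure (r g) {a} \<le> g (a n) / ?S" if "?S > 0"
  proof -
    have "measure (r g) {a} \<le> \<P>(A in r g. A n = a n)"
      using a by (intro r.finite_measure_mono) (auto simp: space_r sets_r)
    then show ?thesis
      using r_marginal[OF g that _ n, of "a n"] a n by (auto simp: PiE_iff)
  qed
  consider "?S = 0" | "?S > 0" "g p = 0" | "?S > 0" "g p > 0"
    using g0[OF p] \<open>0 \<le> ?S\<close> by fastforce
  then show ?thesis
  proof cases
    case 1
    then have "g p = 0"
      using sum_nonneg_eq_0_iff[of "{1..N}" g] g0 p by simp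
    with 1 show ?thesis by simp
  next
    case 2
    then show ?thesis
      using r_le by (auto simp: r.emeasure_eq_measure intro: antisym)
  next
    case 3
    then have qr: "q p n g = rc p n g" by (simp add: cond_resample_def)
    show ?thesis
    proof (cases "a n = p")
      case True
      have "measure (q p n g) {a} = \<P>(A in r g. (\<forall>i\<in>{1..N} - {n}. A i = a i) \<bar> A n = p)"
        unfolding qr using g 3 p n a True by (intro rc_conditional) auto
      also have "\<dots> = \<P>(A in r g. (\<forall>i\<in>{1..N} - {n}. A i = a i) \<and> A n = p) / (g p / ?S)"
        unfolding cond_prob_def using r_marginal[OF g _ p n] 3 by simp
      \<comment> \<open>Extensional functions that agree with \<open>a\<close> off \<open>n\<close>
        and take the value \<open>p = a n\<close> at \<open>n\<close> coincide with
        \<open>a\<close>, so the numerator is the probability of an atom.\<close>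
      also have "{A \<in> space (r g). (\<forall>i\<in>{1..N} - {n}. A i = a i) \<and> A n = p} = {a}"
        using a True unfolding space_r by (auto intro!: PiE_ext[of _ "{1..N}" "\<lambda>_. {1..N}"])
      finally have "g p * measure (q p n g) {a} = ?S * measure (r g) {a}"
        using 3 by simp
      with True 3 show ?thesis
        by (simp add: r.emeasure_eq_measure q.emeasure_eq_measure flip: ennreal_mult'')
    next
      case False
      \<comment> \<open>By (i) the event \<open>A n \<noteq> p\<close> is null, and it contains
        \<open>a\<close>.\<close>
      have "measure (q p n g) {a} \<le> \<P>(A in q p n g. A n \<noteq> p)"
        using a False by (intro q.finite_measure_mono) (auto simp: space_q sets_q)
      also have "\<dots> = 0"
        using rc_reference[OF g _ p n] 3 unfolding qr[symmetric]
        by (subst q.prob_neg) (auto simp: sets_q space_q)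
      finally have "emeasure (q p n g) {a} = 0"
        using measure_nonneg[of "q p n g" "{a}"] by (simp add: q.emeasure_eq_measure)
      with False show ?thesis by simp
    qed
  qed
qed

text \<open>In the sum of the atomwise identity over \<open>p\<close>, each \<open>a\<close> retains
  only the term \<open>p = a n\<close>: the reference index is traded for the ancestor of position
  \<open>n\<close>. Integrals over index vectors are finite sums, so \<open>f\<close> can be
  arbitrary.\<close>

lemma nn_integral_conditional_resampling:
  assumes g: "g \<in> space (weight_space N)" and n: "n \<in> {1..N}"
  shows "(\<Sum>p=1..N. ennreal (g p) * (\<integral>\<^sup>+A. f p A \<partial>q p n g)) =
    ennreal (\<Sum>i=1..N. g i) * (\<integral>\<^sup>+A. f (A n) A \<partial>r g)"
proof -
  let ?I = "{1..N} \<rightarrow>\<^sub>E {1..N}" and ?S = "ennreal (\<Sum>i=1..N. g i)"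
  have sets_r: "sets (r g) = Pow ?I"
    using measurable_space[OF r_scheme[unfolded resampling_scheme_def] g]
    by (auto simp: space_prob_algebra index_vectors_def)
  have sets_q: "sets (q p n g) = Pow ?I" if "p \<in> {1..N}" for p
    using measurable_space[OF measurable_q[OF that n] g]
    by (auto simp: space_prob_algebra index_vectors_def)
  have fin: "finite ?I" by (intro finite_PiE) auto
  have "(\<Sum>p=1..N. ennreal (g p) * (\<integral>\<^sup>+A. f p A \<partial>q p n g)) =
      (\<Sum>p=1..N. \<Sum>a\<in>?I. (ennreal (g p) * emeasure (q p n g) {a}) * f p a)"
    by (intro sum.cong refl) (simp add: nn_integral_finite_sets[OF fin sets_q] sum_distrib_left mult.assoc)
  also have "\<dots> = (\<Sum>a\<in>?I. \<Sum>p=1..N. (if a n = p then ?S * emeasure (r g) {a} * f p a else 0))"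
    by (subst sum.swap, intro sum.cong refl, subst conditional_resampling_atom[OF g _ n]) auto
  also have "\<dots> = (\<Sum>a\<in>?I. ?S * emeasure (r g) {a} * f (a n) a)"
    using n by (intro sum.cong refl) (auto simp: sum.delta')
  also have "\<dots> = ?S * (\<integral>\<^sup>+A. f (A n) A \<partial>r g)"
    by (simp add: nn_integral_finite_sets[OF fin sets_r] sum_distrib_left mult.assoc)
  finally show ?thesis .
qed

end

section \<open>Measurability of the forward pass\<close>

lemma measurable_history_particles:
  assumes "f \<in> S \<rightarrow>\<^sub>M history_space X N m" "k \<in> {1..Suc m}"
  shows "(\<lambda>s. fst (f s) k) \<in> S \<rightarrow>\<^sub>M (\<Pi>\<^sub>M i\<in>{1..N}. X)"
proof -
  have "(\<lambda>s. fst (f s)) \<in> S \<rightarrow>\<^sub>M (\<Pi>\<^sub>M k\<in>{1..Suc m}. \<Pi>\<^sub>M i\<in>{1..N}. X)"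
    using assms(1) unfolding history_space_def by (rule measurable_compose) measurable
  then show ?thesis
    by (rule measurable_compose[OF _ measurable_component_singleton[OF assms(2)]])
qed

lemma measurable_history_particle:
  assumes "f \<in> S \<rightarrow>\<^sub>M history_space X N m" "k \<in> {1..Suc m}" "i \<in> {1..N}"
  shows "(\<lambda>s. fst (f s) k i) \<in> S \<rightarrow>\<^sub>M X"
  by (rule measurable_compose[OF measurable_history_particles[OF assms(1,2)] measurable_component_singleton[OF assms(3)]])

lemma measurable_history_ancestors:
  assumes "f \<in> S \<rightarrow>\<^sub>M history_space X N m" "k \<in> {1..m}"
  shows "(\<lambda>s. snd (f s) k) \<in> S \<rightarrow>\<^sub>M index_vectors N"
proof -
  have "(\<lambda>s. snd (f s)) \<in> S \<rightarrow>\<^sub>M (\<Pi>\<^sub>M k\<in>{1..m}. index_vectors N)"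
    using assms(1) unfolding history_space_def by (rule measurable_compose) measurable
  then show ?thesis
    by (rule measurable_compose[OF _ measurable_component_singleton[OF assms(2)]])
qed

lemma measurable_history_particle_index:
  assumes f: "f \<in> S \<rightarrow>\<^sub>M history_space X N m" and k: "k \<in> {1..Suc m}" and j: "j \<in> S \<rightarrow>\<^sub>M count_space {1..N}"
  shows "(\<lambda>s. fst (f s) k (j s)) \<in> S \<rightarrow>\<^sub>M X"
  by (rule measurable_compose_countable'[OF measurable_history_particle[OF f k] j]) auto

lemma measurable_history_ancestor_index:
  assumes f: "f \<in> S \<rightarrow>\<^sub>M history_space X N m" and k: "k \<in> {1..m}" and j: "j \<in> S \<rightarrow>\<^sub>M count_space {1..N}"
  shows "(\<lambda>s. snd (f s) k (j s)) \<in> S \<rightarrow>\<^sub>M count_space {1..N}"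
  by (rule measurable_compose_countable'[OF measurable_index_component[OF measurable_history_ancestors[OF f k]] j]) auto

text \<open>A state after \<open>m\<close> resampling steps ends with particles at time
  \<open>m + 1\<close>; hence one more step writes particles at time \<open>m + 2\<close> but
  ancestors at time \<open>m + 1\<close>.\<close>

definition extend_history ::
  "nat \<Rightarrow> ((nat \<Rightarrow> nat \<Rightarrow> 'a) \<times> (nat \<Rightarrow> nat \<Rightarrow> nat)) \<Rightarrow> (nat \<Rightarrow> nat) \<Rightarrow> (nat \<Rightarrow> 'a)
     \<Rightarrow> (nat \<Rightarrow> nat \<Rightarrow> 'a) \<times> (nat \<Rightarrow> nat \<Rightarrow> nat)" where
  "extend_history m h A x = ((fst h)(Suc (Suc m) := x), (snd h)(Suc m := A))"

lemma measurable_extend_history: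
  assumes f: "f \<in> S \<rightarrow>\<^sub>M history_space X N m"
    and A: "A \<in> S \<rightarrow>\<^sub>M index_vectors N" and x: "x \<in> S \<rightarrow>\<^sub>M (\<Pi>\<^sub>M i\<in>{1..N}. X)"
  shows "(\<lambda>s. extend_history m (f s) (A s) (x s)) \<in> S \<rightarrow>\<^sub>M history_space X N (Suc m)"
  unfolding extend_history_def history_space_def
proof (rule measurable_Pair)
  have *: "(\<lambda>s. fst (f s)) \<in> S \<rightarrow>\<^sub>M (\<Pi>\<^sub>M k\<in>{1..Suc m}. \<Pi>\<^sub>M i\<in>{1..N}. X)"
    "(\<lambda>s. snd (f s)) \<in> S \<rightarrow>\<^sub>M (\<Pi>\<^sub>M k\<in>{1..m}. index_vectors N)"
    using f unfolding history_space_def by (rule measurable_compose, measurable)+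
  show "(\<lambda>s. (fst (f s))(Suc (Suc m) := x s)) \<in> S \<rightarrow>\<^sub>M (\<Pi>\<^sub>M k\<in>{1..Suc (Suc m)}. \<Pi>\<^sub>M i\<in>{1..N}. X)"
    using *(1) x by (rule measurable_fun_upd[rotated]) auto
  show "(\<lambda>s. (snd (f s))(Suc m := A s)) \<in> S \<rightarrow>\<^sub>M (\<Pi>\<^sub>M k\<in>{1..Suc m}. index_vectors N)"
    using *(2) A by (rule measurable_fun_upd[rotated]) auto
qed

section \<open>Potentials and particle weights\<close>

context feynman_kac
begin

lemma M1_borel: "M1 \<in> borel_measurable X" and M1_nonneg: "x \<in> space X \<Longrightarrow> 0 \<le> M1 x"
  using M1_measurable by (auto simp: measurable_restrict_space2_iff)

lemma G1_borel: "G1 \<in> borel_measurable X" and G1_nonneg: "x \<in> space X \<Longrightarrow> 0 \<le> G1 x"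
  using G1_measurable by (auto simp: measurable_restrict_space2_iff)

lemma M_borel:
  assumes "k \<in> {2..T}" "f \<in> S \<rightarrow>\<^sub>M X" "g \<in> S \<rightarrow>\<^sub>M X"
  shows "(\<lambda>s. M k (f s) (g s)) \<in> borel_measurable S"
proof -
  have "(\<lambda>(x, y). M k x y) \<in> borel_measurable (X \<Otimes>\<^sub>M X)"
    using M_measurable[OF assms(1)] by (simp add: measurable_restrict_space2_iff)
  from measurable_compose[OF measurable_Pair[OF assms(2,3)] this] show ?thesis by simp
qed

lemma M_nonneg:
  assumes "k \<in> {2..T}" "x \<in> space X" "y \<in> space X" shows "0 \<le> M k x y"
  using measurable_space[OF M_measurable[OF assms(1)], of "(x, y)"] assms
  by (auto simp: space_restrict_space space_pair_measure)

lemma G_borel: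
  assumes "k \<in> {2..T}" "f \<in> S \<rightarrow>\<^sub>M X" "g \<in> S \<rightarrow>\<^sub>M X"
  shows "(\<lambda>s. G k (f s) (g s)) \<in> borel_measurable S"
proof -
  have "(\<lambda>(x, y). G k x y) \<in> borel_measurable (X \<Otimes>\<^sub>M X)"
    using G_measurable[OF assms(1)] by (simp add: measurable_restrict_space2_iff)
  from measurable_compose[OF measurable_Pair[OF assms(2,3)] this] show ?thesis by simp
qed

lemma G_nonneg:
  assumes "k \<in> {2..T}" "x \<in> space X" "y \<in> space X" shows "0 \<le> G k x y"
  using measurable_space[OF G_measurable[OF assms(1)], of "(x, y)"] assms
  by (auto simp: space_restrict_space space_pair_measure)

text \<open>A common language for path densities and particle weights, covering the special first
  time as well.\<close>

definition potential :: "nat \<Rightarrow> (nat \<Rightarrow> 'a) \<Rightarrow> real" where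
  "potential k x = (if k = 1 then G1 (x 1) else G k (x (k - 1)) (x k))"

lemma potential_borel:
  assumes "k \<in> {1..T}" "\<And>l. l \<in> {1..k} \<Longrightarrow> (\<lambda>s. x s l) \<in> S \<rightarrow>\<^sub>M X"
  shows "(\<lambda>s. potential k (x s)) \<in> borel_measurable S"
proof (cases "k = 1")
  case True
  then show ?thesis
    using measurable_compose[OF assms(2) G1_borel, of 1] by (simp add: potential_def)
next
  case False
  then show ?thesis
    using assms(1) unfolding potential_def by (auto intro!: G_borel assms(2))
qed

lemma potential_nonneg:
  assumes "k \<in> {1..T}" "\<And>l. l \<in> {1..k} \<Longrightarrow> x l \<in> space X"
  shows "0 \<le> potential k x"
  using assms by (auto simp: potential_def intro!: G1_nonneg G_nonneg)

text \<open>\<open>potential k\<close> reads only times \<open>k - 1\<close> and \<open>k\<close>,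
  and the path on the right has the correct parent at time \<open>k - 1\<close>. Each of its entries
  is a single lookup, so measurability of the weights follows before backward tracing is
  introduced.\<close>

lemma weights_eq_potential:
  assumes "i \<in> {1..N}" "1 \<le> k"
  shows "weights N G1 G k x a i = potential k (\<lambda>l. if l = k then x k i else x l (a l i))"
  using assms by (auto simp: weights_def potential_def)

lemma measurable_weights:
  assumes f: "f \<in> S \<rightarrow>\<^sub>M history_space X N m" and m: "Suc m \<le> T"
  shows "(\<lambda>s. weights N G1 G (Suc m) (fst (f s)) (snd (f s))) \<in> S \<rightarrow>\<^sub>M weight_space N"
proof -
  have *: "(\<lambda>s. weights N G1 G (Suc m) (fst (f s)) (snd (f s)) i) \<in> S \<rightarrow>\<^sub>M nonneg_borel"
    if i: "i \<in> {1..N}" for i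
  proof -
    have x: "(\<lambda>s. if l = Suc m then fst (f s) (Suc m) i else fst (f s) l (snd (f s) l i)) \<in> S \<rightarrow>\<^sub>M X"
      if l: "l \<in> {1..Suc m}" for l
    proof (cases "l = Suc m")
      case True
      then show ?thesis using measurable_history_particle[OF f _ i, of "Suc m"] by simp
    next
      case False
      then show ?thesis
        using measurable_history_particle_index[OF f l measurable_history_ancestor_index[OF f _ measurable_const]] l i
        by simp
    qed
    show ?thesis
      unfolding weights_eq_potential[OF i le_add1[of 1 m, unfolded plus_1_eq_Suc]]
      using m by (intro measurable_restrict_space2 potential_borel x)
        (auto intro!: potential_nonneg measurable_space[OF x])
  qed
  show ?thesis
    unfolding weight_space_def
    using measurable_space[OF *] by (intro measurable_PiM_single' *) (auto simp: weights_def extensional_def)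
qed

end

section \<open>Kernels of the forward pass\<close>

context particle_filter
begin

lemma measurable_draw_initial:
  assumes "y \<in> S \<rightarrow>\<^sub>M X"
  shows "(\<lambda>s. draw_particles X N n (y s) (\<lambda>i. M1)) \<in> S \<rightarrow>\<^sub>M prob_algebra (\<Pi>\<^sub>M i\<in>{1..N}. X)"
  using M1_borel M1_density by (intro measurable_draw_particles assms) auto

lemma measurable_draw_transition:
  assumes y: "y \<in> S \<rightarrow>\<^sub>M X" and f: "f \<in> S \<rightarrow>\<^sub>M history_space X N m"
    and A: "A \<in> S \<rightarrow>\<^sub>M index_vectors N" and m: "Suc (Suc m) \<le> T"
  shows "(\<lambda>s. draw_particles X N n (y s) (\<lambda>i. M (Suc (Suc m)) (fst (f s) (Suc m) (A s i))))
    \<in> S \<rightarrow>\<^sub>M prob_algebra (\<Pi>\<^sub>M i\<in>{1..N}. X)"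
proof (rule measurable_draw_particles[OF y])
  fix i assume i: "i \<in> {1..N}"
  have x: "(\<lambda>s. fst (f s) (Suc m) (A s i)) \<in> S \<rightarrow>\<^sub>M X"
    by (rule measurable_history_particle_index[OF f _ measurable_index_component[OF A i]]) simp
  then have [measurable]: "(\<lambda>s. fst (f (fst s)) (Suc m) (A (fst s) i)) \<in> S \<Otimes>\<^sub>M X \<rightarrow>\<^sub>M X"
    by measurable
  show "(\<lambda>(s, z). M (Suc (Suc m)) (fst (f s) (Suc m) (A s i)) z) \<in> borel_measurable (S \<Otimes>\<^sub>M X)"
    using m unfolding case_prod_beta by (intro M_borel) auto
  show "(\<integral>\<^sup>+z. ennreal (M (Suc (Suc m)) (fst (f s) (Suc m) (A s i)) z) \<partial>X) = 1" if "s \<in> space S" for s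
    using m measurable_space[OF x that] by (intro M_density) auto
qed

text \<open>One iteration of \<open>cpf_forward\<close> with the reference data as parameters, so
  that \<open>p\<close> and \<open>n\<close> stay constant while \<open>y\<close> and the history
  vary measurably.\<close>

definition particle_step ::
  "nat \<Rightarrow> nat \<Rightarrow> nat \<Rightarrow> 'a \<Rightarrow> ((nat \<Rightarrow> nat \<Rightarrow> 'a) \<times> (nat \<Rightarrow> nat \<Rightarrow> nat))
     \<Rightarrow> ((nat \<Rightarrow> nat \<Rightarrow> 'a) \<times> (nat \<Rightarrow> nat \<Rightarrow> nat)) measure" where
  "particle_step m p n y h =
     q p n (weights N G1 G (Suc m) (fst h) (snd h)) \<bind> (\<lambda>A.
     draw_particles X N n y (\<lambda>i. M (Suc (Suc m)) (fst h (Suc m) (A i))) \<bind> (\<lambda>x.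
     return (history_space X N (Suc m)) (extend_history m h A x)))"

abbreviation forward :: "(nat \<Rightarrow> 'a) \<Rightarrow> (nat \<Rightarrow> nat) \<Rightarrow> nat
     \<Rightarrow> ((nat \<Rightarrow> nat \<Rightarrow> 'a) \<times> (nat \<Rightarrow> nat \<Rightarrow> nat)) measure" where
  "forward \<equiv> cpf_forward X N M1 M G1 G q"

lemma forward_Suc:
  "forward xs b (Suc m) = forward xs b m \<bind> particle_step m (b (Suc m)) (b (Suc (Suc m))) (xs (Suc (Suc m)))"
  by (simp add: particle_step_def[abs_def] case_prod_beta' extend_history_def)

lemma measurable_resample_step:
  assumes f: "f \<in> S \<rightarrow>\<^sub>M history_space X N m" and m: "Suc (Suc m) \<le> T"
    and p: "p \<in> {1..N}" and n: "n \<in> {1..N}"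
  shows "(\<lambda>s. q p n (weights N G1 G (Suc m) (fst (f s)) (snd (f s)))) \<in> S \<rightarrow>\<^sub>M prob_algebra (index_vectors N)"
  using m by (intro measurable_compose[OF measurable_weights[OF f] measurable_q[OF p n]]) simp

lemma measurable_step_return:
  assumes f: "f \<in> S \<rightarrow>\<^sub>M history_space X N m" and A: "A \<in> S \<rightarrow>\<^sub>M index_vectors N"
  shows "(\<lambda>(s, x). return (history_space X N (Suc m)) (extend_history m (f s) (A s) x))
    \<in> S \<Otimes>\<^sub>M (\<Pi>\<^sub>M i\<in>{1..N}. X) \<rightarrow>\<^sub>M prob_algebra (history_space X N (Suc m))"
  unfolding case_prod_beta
  by (rule measurable_compose[OF measurable_extend_history measurable_return_prob_space])
    (rule measurable_compose[OF measurable_fst f] measurable_compose[OF measurable_fst A] measurable_snd)+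

lemma measurable_step_draw:
  assumes y: "y \<in> S \<rightarrow>\<^sub>M X" and f: "f \<in> S \<rightarrow>\<^sub>M history_space X N m"
    and A: "A \<in> S \<rightarrow>\<^sub>M index_vectors N" and m: "Suc (Suc m) \<le> T"
  shows "(\<lambda>s. draw_particles X N n (y s) (\<lambda>i. M (Suc (Suc m)) (fst (f s) (Suc m) (A s i))) \<bind> (\<lambda>x.
     return (history_space X N (Suc m)) (extend_history m (f s) (A s) x))) \<in> S \<rightarrow>\<^sub>M prob_algebra (history_space X N (Suc m))"
  by (rule measurable_bind_prob_space2[OF measurable_draw_transition[OF assms] measurable_step_return[OF f A]])

lemma measurable_particle_step:
  assumes y: "y \<in> S \<rightarrow>\<^sub>M X" and f: "f \<in> S \<rightarrow>\<^sub>M history_space X N m" and m: "Suc (Suc m) \<le> T"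
    and p: "p \<in> {1..N}" and n: "n \<in> {1..N}"
  shows "(\<lambda>s. particle_step m p n (y s) (f s)) \<in> S \<rightarrow>\<^sub>M prob_algebra (history_space X N (Suc m))"
  unfolding particle_step_def
proof (rule measurable_bind_prob_space2[OF measurable_resample_step[OF f m p n]])
  have [measurable]: "y \<in> S \<rightarrow>\<^sub>M X" "f \<in> S \<rightarrow>\<^sub>M history_space X N m" by fact+
  show "(\<lambda>(s, A). draw_particles X N n (y s) (\<lambda>i. M (Suc (Suc m)) (fst (f s) (Suc m) (A i))) \<bind> (\<lambda>x.
     return (history_space X N (Suc m)) (extend_history m (f s) A x)))
     \<in> S \<Otimes>\<^sub>M index_vectors N \<rightarrow>\<^sub>M prob_algebra (history_space X N (Suc m))"
    unfolding case_prod_beta using m by (intro measurable_step_draw) measurable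
qed

text \<open>With no earlier particles and no ancestors, both components start from the product over
  no times, whose only point is the undefined function.\<close>

lemma measurable_initial_history:
  "(\<lambda>x. ((\<lambda>k. undefined)(1 := x), \<lambda>k. undefined)) \<in> (\<Pi>\<^sub>M i\<in>{1..N}. X) \<rightarrow>\<^sub>M history_space X N 0"
  unfolding history_space_def
  by (intro measurable_Pair measurable_fun_upd[where J="{}"]) (auto simp: space_PiM)

text \<open>The indices \<open>b\<close> are held fixed here; they range over a finite set, and
  joint measurability with the path is recovered by gluing in
  \<open>measurable_cpf_at\<close>.\<close>

lemma measurable_forward:
  assumes "Suc m \<le> T" "\<And>k. k \<in> {1..Suc m} \<Longrightarrow> (\<lambda>s. xs s k) \<in> S \<rightarrow>\<^sub>M X"
    and "\<And>k. k \<in> {1..Suc m} \<Longrightarrow> b k \<in> {1..N}"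
  shows "(\<lambda>s. forward (xs s) b m) \<in> S \<rightarrow>\<^sub>M prob_algebra (history_space X N m)"
  using assms
proof (induction m)
  case 0
  then show ?case
    using measurable_draw_initial[of "\<lambda>s. xs s 1" S "b 1"] measurable_initial_history
    by (auto intro!: measurable_bind_prob_space measurable_compose[OF _ measurable_return_prob_space])
next
  case (Suc m)
  have "(\<lambda>s. forward (xs s) b m) \<in> S \<rightarrow>\<^sub>M prob_algebra (history_space X N m)"
    using Suc.prems by (intro Suc.IH) auto
  moreover have "(\<lambda>(s, h). particle_step m (b (Suc m)) (b (Suc (Suc m))) (xs s (Suc (Suc m))) h)
      \<in> S \<Otimes>\<^sub>M history_space X N m \<rightarrow>\<^sub>M prob_algebra (history_space X N (Suc m))"
    unfolding case_prod_beta
    using Suc.prems measurable_compose[OF measurable_fst Suc.prems(2)[of "Suc (Suc m)"]]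
    by (intro measurable_particle_step) auto
  ultimately show ?case
    unfolding forward_Suc by (rule measurable_bind_prob_space2)
qed

lemma nn_integral_particle_step:
  assumes y: "y \<in> space X" and h: "h \<in> space (history_space X N m)" and m: "Suc (Suc m) \<le> T"
    and p: "p \<in> {1..N}" and n: "n \<in> {1..N}"
    and f[measurable]: "f \<in> borel_measurable (history_space X N (Suc m))"
  shows "(\<integral>\<^sup>+h'. f h' \<partial>particle_step m p n y h) =
    (\<integral>\<^sup>+A. \<integral>\<^sup>+x. f (extend_history m h A x)
      \<partial>draw_particles X N n y (\<lambda>i. M (Suc (Suc m)) (fst h (Suc m) (A i)))
      \<partial>q p n (weights N G1 G (Suc m) (fst h) (snd h)))"
proof -
  let ?Q = "q p n (weights N G1 G (Suc m) (fst h) (snd h))"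
  let ?D = "\<lambda>A. draw_particles X N n y (\<lambda>i. M (Suc (Suc m)) (fst h (Suc m) (A i)))"
  let ?H = "history_space X N (Suc m)"
  have h': "(\<lambda>_. h) \<in> S \<rightarrow>\<^sub>M history_space X N m" for S :: "'z measure"
    using h by simp
  have y': "(\<lambda>_. y) \<in> S \<rightarrow>\<^sub>M X" for S :: "'z measure"
    using y by simp
  have "weights N G1 G (Suc m) (fst h) (snd h) \<in> space (weight_space N)"
    using m by (intro measurable_space[OF measurable_weights[OF measurable_ident_sets[OF refl]] h]) simp
  then have "?Q \<in> space (prob_algebra (index_vectors N))"
    by (rule measurable_space[OF measurable_q[OF p n]])
  then have sets_Q[measurable_cong]: "sets ?Q = sets (index_vectors N)"
    by (simp add: space_prob_algebra)
  have D: "?D \<in> index_vectors N \<rightarrow>\<^sub>M prob_algebra (\<Pi>\<^sub>M i\<in>{1..N}. X)"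
    using measurable_draw_transition[OF y' h' measurable_ident_sets[OF refl] m] by simp
  have "(\<lambda>A. ?D A \<bind> (\<lambda>x. return ?H (extend_history m h A x))) \<in> index_vectors N \<rightarrow>\<^sub>M prob_algebra ?H"
    using measurable_step_draw[OF y' h' measurable_ident_sets[OF refl] m] by simp
  then have "(\<integral>\<^sup>+h'. f h' \<partial>particle_step m p n y h) =
      (\<integral>\<^sup>+A. \<integral>\<^sup>+h'. f h' \<partial>(?D A \<bind> (\<lambda>x. return ?H (extend_history m h A x))) \<partial>?Q)"
    unfolding particle_step_def
    by (intro nn_integral_bind[OF f]) (simp add: measurable_prob_algebraD measurable_cong_sets[OF sets_Q refl])
  also have "\<dots> = (\<integral>\<^sup>+A. \<integral>\<^sup>+x. f (extend_history m h A x) \<partial>?D A \<partial>?Q)"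
  proof (rule nn_integral_cong)
    fix A assume "A \<in> space ?Q"
    then have A: "A \<in> space (index_vectors N)"
      using sets_eq_imp_space_eq[OF sets_Q] by simp
    have sets_D[measurable_cong]: "sets (?D A) = sets (\<Pi>\<^sub>M i\<in>{1..N}. X)"
      using measurable_space[OF D A] by (simp add: space_prob_algebra)
    have ext[measurable]: "extend_history m h A \<in> (\<Pi>\<^sub>M i\<in>{1..N}. X) \<rightarrow>\<^sub>M ?H"
      using measurable_extend_history[OF h' _ measurable_ident_sets[OF refl]] A by simp
    have "(\<integral>\<^sup>+h'. f h' \<partial>(?D A \<bind> (\<lambda>x. return ?H (extend_history m h A x)))) =
        (\<integral>\<^sup>+x. \<integral>\<^sup>+h'. f h' \<partial>return ?H (extend_history m h A x) \<partial>?D A)"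
      by (intro nn_integral_bind[OF f]) measurable
    also have "\<dots> = (\<integral>\<^sup>+x. f (extend_history m h A x) \<partial>?D A)"
      using measurable_space[OF ext] unfolding sets_eq_imp_space_eq[OF sets_D, symmetric]
      by (intro nn_integral_cong nn_integral_return f)
    finally show "(\<integral>\<^sup>+h'. f h' \<partial>(?D A \<bind> (\<lambda>x. return ?H (extend_history m h A x)))) =
      (\<integral>\<^sup>+x. f (extend_history m h A x) \<partial>?D A)" .
  qed
  finally show ?thesis .
qed

end

section \<open>Lineages and the unconditional particle filter\<close>

lemma sum_PiE_insert:
  assumes "i \<notin> I"
  shows "(\<Sum>b\<in>insert i I \<rightarrow>\<^sub>E J. f b) = (\<Sum>b\<in>I \<rightarrow>\<^sub>E J. \<Sum>n\<in>J. f (b(i := n)))"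
proof -
  have "(\<Sum>b\<in>insert i I \<rightarrow>\<^sub>E J. f b) = (\<Sum>(n, b)\<in>J \<times> (I \<rightarrow>\<^sub>E J). f (b(i := n)))"
    unfolding PiE_insert_eq using inj_combinator[OF assms, of "\<lambda>_. J"]
    by (subst sum.reindex) (auto simp: case_prod_beta' comp_def)
  also have "\<dots> = (\<Sum>b\<in>I \<rightarrow>\<^sub>E J. \<Sum>n\<in>J. f (b(i := n)))"
    by (subst sum.swap) (simp add: sum.cartesian_product)
  finally show ?thesis .
qed

lemma (in sigma_finite_measure) nn_integral_path_insert:
  assumes "finite I" "i \<notin> I" "f \<in> borel_measurable (\<Pi>\<^sub>M k\<in>insert i I. M)"
  shows "(\<integral>\<^sup>+x. f x \<partial>(\<Pi>\<^sub>M k\<in>insert i I. M)) = (\<integral>\<^sup>+x. \<integral>\<^sup>+y. f (x(i := y)) \<partial>M \<partial>(\<Pi>\<^sub>M k\<in>I. M))"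
proof -
  interpret product_sigma_finite "\<lambda>_. M" ..
  show ?thesis using assms by (rule product_nn_integral_insert)
qed

lemma measurable_path_update:
  assumes "f \<in> S \<rightarrow>\<^sub>M (\<Pi>\<^sub>M k\<in>{1..m}. X)" "y \<in> S \<rightarrow>\<^sub>M X"
  shows "(\<lambda>s. (f s)(Suc m := y s)) \<in> S \<rightarrow>\<^sub>M (\<Pi>\<^sub>M k\<in>{1..Suc m}. X)"
  using assms by (rule measurable_fun_upd[rotated]) auto

text \<open>\<open>trace_back\<close> counts backwards from the final time \<open>Suc m\<close>,
  hence the depth \<open>Suc m - k\<close> at time \<open>k\<close>. The restriction makes this
  literally the index vector that \<open>cpf_at\<close> returns.\<close>

definition lineage :: "nat \<Rightarrow> ('x \<times> (nat \<Rightarrow> nat \<Rightarrow> nat)) \<Rightarrow> nat \<Rightarrow> nat \<Rightarrow> nat" where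
  "lineage m h j = (\<lambda>k\<in>{1..Suc m}. trace_back (snd h) (Suc m) j (Suc m - k))"

definition lineage_path :: "nat \<Rightarrow> ((nat \<Rightarrow> nat \<Rightarrow> 'a) \<times> (nat \<Rightarrow> nat \<Rightarrow> nat)) \<Rightarrow> nat \<Rightarrow> nat \<Rightarrow> 'a" where
  "lineage_path m h j = (\<lambda>k\<in>{1..Suc m}. fst h k (lineage m h j k))"

text \<open>The recursion of \<open>trace_back\<close> peels off the step furthest in the past; here
  the latest one is peeled off, as appending a generation requires.\<close>

lemma trace_back_Suc_Suc: "trace_back a (Suc t) j (Suc i) = trace_back a t (a t j) i"
  by (induction i) auto

text \<open>Tracing back from time \<open>Suc m\<close> consults ancestors at times at most
  \<open>m\<close>, never the entry being overwritten.\<close>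

lemma trace_back_upd: "trace_back (a(Suc m := A)) (Suc m) j i = trace_back a (Suc m) j i"
  by (induction i) auto

lemma lineage_last: "lineage m h j (Suc m) = j"
  by (simp add: lineage_def)

lemma lineage_path_last: "lineage_path m h j (Suc m) = fst h (Suc m) j"
  by (simp add: lineage_path_def lineage_last)

text \<open>A new particle inherits the lineage of its parent \<open>A n\<close>: the latest
  ancestor is peeled off with \<open>trace_back_Suc_Suc\<close>, and the update is then invisible by
  \<open>trace_back_upd\<close>.\<close>

lemma lineage_extend_history:
  "lineage (Suc m) (extend_history m h A x) n = (lineage m h (A n))(Suc (Suc m) := n)"
proof
  fix k
  consider "k \<in> {1..Suc m}" | "k = Suc (Suc m)" | "k \<notin> {1..Suc (Suc m)}" by fastforce
  then show "lineage (Suc m) (extend_history m h A x) n k = ((lineage m h (A n))(Suc (Suc m) := n)) k"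
  proof cases
    case 1
    then have "Suc (Suc m) - k = Suc (Suc m - k)" by auto
    with 1 show ?thesis
      by (simp add: lineage_def extend_history_def trace_back_Suc_Suc trace_back_upd del: trace_back.simps)
  qed (auto simp: lineage_def)
qed

lemma lineage_path_extend_history:
  "lineage_path (Suc m) (extend_history m h A x) n = (lineage_path m h (A n))(Suc (Suc m) := x n)"
proof -
  have "fst (extend_history m h A x) = (fst h)(Suc (Suc m) := x)"
    by (simp add: extend_history_def)
  then show ?thesis
    by (auto simp: fun_eq_iff lineage_path_def lineage_extend_history)
qed

lemma measurable_trace_back:
  assumes f: "f \<in> S \<rightarrow>\<^sub>M history_space X N m" and j: "j \<in> {1..N}" and i: "i \<le> m"
  shows "(\<lambda>s. trace_back (snd (f s)) (Suc m) j i) \<in> S \<rightarrow>\<^sub>M count_space {1..N}"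
  using i
proof (induction i)
  case 0
  then show ?case using j by simp
next
  case (Suc i)
  then show ?case
    using measurable_history_ancestor_index[OF f, of "m - i"] by simp
qed

lemma measurable_lineage_component:
  assumes f: "f \<in> S \<rightarrow>\<^sub>M history_space X N m" and j: "j \<in> {1..N}" and k: "k \<in> {1..Suc m}"
  shows "(\<lambda>s. lineage m (f s) j k) \<in> S \<rightarrow>\<^sub>M count_space {1..N}"
proof -
  have "Suc m - k \<le> m" using k by auto
  then show ?thesis
    using measurable_trace_back[OF f j] k by (simp add: lineage_def)
qed

lemma measurable_lineage:
  assumes f: "f \<in> S \<rightarrow>\<^sub>M history_space X N m" and j: "j \<in> {1..N}"
  shows "(\<lambda>s. lineage m (f s) j) \<in> S \<rightarrow>\<^sub>M count_space ({1..Suc m} \<rightarrow>\<^sub>E {1..N})"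
proof -
  have "(\<lambda>s. lineage m (f s) j) \<in> S \<rightarrow>\<^sub>M (\<Pi>\<^sub>M k\<in>{1..Suc m}. count_space {1..N})"
    using measurable_space[OF measurable_lineage_component[OF f j]]
    by (intro measurable_PiM_single' measurable_lineage_component[OF f j]) (auto simp: lineage_def extensional_def)
  then show ?thesis
    by (subst (asm) count_space_PiM_finite) auto
qed

lemma measurable_lineage_path:
  assumes f: "f \<in> S \<rightarrow>\<^sub>M history_space X N m" and j: "j \<in> {1..N}"
  shows "(\<lambda>s. lineage_path m (f s) j) \<in> S \<rightarrow>\<^sub>M (\<Pi>\<^sub>M k\<in>{1..Suc m}. X)"
  unfolding lineage_path_def
  by (intro measurable_restrict measurable_history_particle_index[OF f] measurable_lineage_component[OF f j])

text \<open>A weight sees at most one parent, the next-to-last entry of the lineage. Thus the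
  potential of a traced reference path is the weight of its reference index, the factor required by
  \<open>nn_integral_conditional_resampling\<close>.\<close>

lemma (in feynman_kac) weights_eq_potential_lineage:
  assumes "i \<in> {1..N}"
  shows "weights N G1 G (Suc m) (fst h) (snd h) i = potential (Suc m) (lineage_path m h i)"
proof (cases m)
  case 0
  then show ?thesis
    using assms by (simp add: weights_def potential_def lineage_path_def lineage_def)
next
  case (Suc l)
  then have "lineage_path m h i m = fst h m (snd h m i)"
    by (simp add: lineage_path_def lineage_def)
  with Suc show ?thesis
    using assms lineage_path_last[of m h i] by (simp add: weights_def potential_def)
qed

text \<open>The unnormalised density at time \<open>m + 1\<close> before multiplication by the last potential.\<close>

primrec (in feynman_kac) predictive :: "nat \<Rightarrow> (nat \<Rightarrow> 'a) \<Rightarrow> real" where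
  "predictive 0 x = M1 (x 1)"
| "predictive (Suc m) x = predictive m x * potential (Suc m) x * M (Suc (Suc m)) (x (Suc m)) (x (Suc (Suc m)))"

section \<open>Predictive path densities\<close>

context feynman_kac
begin

lemma potential_cong: "(\<And>l. l \<in> {1..k} \<Longrightarrow> x l = y l) \<Longrightarrow> 1 \<le> k \<Longrightarrow> potential k x = potential k y"
  by (auto simp: potential_def)

lemma predictive_cong: "(\<And>l. l \<in> {1..Suc m} \<Longrightarrow> x l = y l) \<Longrightarrow> predictive m x = predictive m y"
proof (induction m)
  case (Suc m)
  then have "predictive m x = predictive m y" by auto
  moreover have "potential (Suc m) x = potential (Suc m) y"
    using Suc.prems by (intro potential_cong) auto
  ultimately show ?case using Suc.prems by simp
qed simp

lemma predictive_borel: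
  assumes "Suc m \<le> T" "\<And>l. l \<in> {1..Suc m} \<Longrightarrow> (\<lambda>s. x s l) \<in> S \<rightarrow>\<^sub>M X"
  shows "(\<lambda>s. predictive m (x s)) \<in> borel_measurable S"
  using assms
proof (induction m)
  case 0
  then show ?case by (auto intro: measurable_compose[OF _ M1_borel])
next
  case (Suc m)
  then show ?case
    by (auto intro!: borel_measurable_times potential_borel M_borel)
qed

lemma predictive_nonneg:
  assumes "Suc m \<le> T" "\<And>l. l \<in> {1..Suc m} \<Longrightarrow> x l \<in> space X"
  shows "0 \<le> predictive m x"
  using assms
proof (induction m)
  case 0
  then show ?case by (auto intro: M1_nonneg)
next
  case (Suc m)
  then show ?case
    by (auto intro!: mult_nonneg_nonneg potential_nonneg M_nonneg)
qed

lemma fk_unnormalised_eq_predictive: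
  "fk_unnormalised (Suc m) M1 M G1 G x = predictive m x * potential (Suc m) x"
proof (induction m)
  case 0
  then show ?case by (simp add: fk_unnormalised_def potential_def)
next
  case (Suc m)
  have "fk_unnormalised (Suc (Suc m)) M1 M G1 G x =
      fk_unnormalised (Suc m) M1 M G1 G x * (M (Suc (Suc m)) (x (Suc m)) (x (Suc (Suc m))) * G (Suc (Suc m)) (x (Suc m)) (x (Suc (Suc m))))"
    by (simp add: fk_unnormalised_def numeral_2_eq_2)
  then show ?case
    unfolding Suc.IH by (simp add: potential_def)
qed

end

section \<open>The reweighted unconditional filter\<close>

context particle_filter
begin

text \<open>
  Integration against the law of the unconditional particle filter, with every resampling step
  reweighted by the total weight.  Only equations between such integrals are needed, so this is a
  functional defined for arbitrary, possibly non-measurable, integrands.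
\<close>

primrec particle_integral ::
  "nat \<Rightarrow> ((nat \<Rightarrow> nat \<Rightarrow> 'a) \<times> (nat \<Rightarrow> nat \<Rightarrow> nat) \<Rightarrow> ennreal) \<Rightarrow> ennreal" where
  "particle_integral 0 f =
    (\<integral>\<^sup>+x. f ((\<lambda>k. undefined)(1 := x), \<lambda>k. undefined) \<partial>(\<Pi>\<^sub>M i\<in>{1..N}. density X M1))"
| "particle_integral (Suc m) f = particle_integral m (\<lambda>h.
    ennreal (\<Sum>i=1..N. weights N G1 G (Suc m) (fst h) (snd h) i) *
    (\<integral>\<^sup>+A. \<integral>\<^sup>+x. f (extend_history m h A x)
      \<partial>(\<Pi>\<^sub>M i\<in>{1..N}. density X (M (Suc (Suc m)) (fst h (Suc m) (A i))))
      \<partial>r (weights N G1 G (Suc m) (fst h) (snd h))))"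

lemma space_weights:
  assumes "h \<in> space (history_space X N m)" "Suc m \<le> T"
  shows "weights N G1 G (Suc m) (fst h) (snd h) \<in> space (weight_space N)"
  using assms(2) by (intro measurable_space[OF measurable_weights[OF measurable_ident_sets[OF refl]] assms(1)])

lemma sets_r: "g \<in> space (weight_space N) \<Longrightarrow> sets (r g) = sets (index_vectors N)"
  using measurable_space[OF r_scheme[unfolded resampling_scheme_def]] by (simp add: space_prob_algebra)

text \<open>All draws stay in the history space, so agreement there propagates through the
  recursion. Only congruence of integrals is used, in keeping with the arbitrary integrands.\<close>

lemma particle_integral_cong:
  assumes "Suc m \<le> T" "\<And>h. h \<in> space (history_space X N m) \<Longrightarrow> f h = g h"
  shows "particle_integral m f = particle_integral m g"
  using assms
proof (induction m arbitrary: f g)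
  case 0
  have "sets (\<Pi>\<^sub>M i\<in>{1..N}. density X M1) = sets (\<Pi>\<^sub>M i\<in>{1..N}. X)"
    by (intro sets_PiM_cong) auto
  note eq = sets_eq_imp_space_eq[OF this]
  show ?case
    using 0 measurable_space[OF measurable_initial_history, folded eq]
    by (auto intro!: nn_integral_cong)
next
  case (Suc m)
  show ?case
    unfolding particle_integral.simps
  proof (intro Suc.IH arg_cong2[where f="(*)"] refl nn_integral_cong Suc.prems(2))
    fix h A x assume h: "h \<in> space (history_space X N m)"
      and A: "A \<in> space (r (weights N G1 G (Suc m) (fst h) (snd h)))"
      and x: "x \<in> space (\<Pi>\<^sub>M i\<in>{1..N}. density X (M (Suc (Suc m)) (fst h (Suc m) (A i))))"
    have "A \<in> space (index_vectors N)"
      using A sets_eq_imp_space_eq[OF sets_r[OF space_weights[OF h]]] Suc.prems(1) by simp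
    moreover have "x \<in> space (\<Pi>\<^sub>M i\<in>{1..N}. X)"
      using x by (simp add: space_PiM)
    ultimately show "extend_history m h A x \<in> space (history_space X N (Suc m))"
      using h measurable_space[OF measurable_extend_history[OF measurable_const measurable_const measurable_ident_sets[OF refl]], of h X N m A x]
      by simp
  qed (use Suc.prems in auto)
qed

text \<open>Causality of the forward pass: the newest reference value and index can be split off
  without affecting the earlier history.\<close>

lemma forward_cong:
  "(\<And>k. k \<in> {1..Suc m} \<Longrightarrow> xs k = xs' k) \<Longrightarrow> (\<And>k. k \<in> {1..Suc m} \<Longrightarrow> b k = b' k) \<Longrightarrow>
    forward xs b m = forward xs' b' m"
proof (induction m)
  case (Suc m)
  have "forward xs b m = forward xs' b' m"
    using Suc.prems by (intro Suc.IH) auto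
  then show ?case
    unfolding forward_Suc using Suc.prems by simp
qed simp


lemma prob_forward:
  assumes "Suc m \<le> T" "xs \<in> space (\<Pi>\<^sub>M k\<in>{1..Suc m}. X)" "b \<in> {1..Suc m} \<rightarrow>\<^sub>E {1..N}"
  shows "forward xs b m \<in> space (prob_algebra (history_space X N m))"
proof -
  have "(\<lambda>xs. forward xs b m) \<in> (\<Pi>\<^sub>M k\<in>{1..Suc m}. X) \<rightarrow>\<^sub>M prob_algebra (history_space X N m)"
    using assms(1,3) by (intro measurable_forward) auto
  then show ?thesis using assms(2) by (rule measurable_space)
qed

lemma measurable_forward_integral:
  assumes m: "Suc m \<le> T" and b: "b \<in> {1..Suc m} \<rightarrow>\<^sub>E {1..N}"
    and f: "(\<lambda>(xs, h). f xs h) \<in> borel_measurable ((\<Pi>\<^sub>M k\<in>{1..Suc m}. X) \<Otimes>\<^sub>M history_space X N m)"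
  shows "(\<lambda>xs. ennreal (predictive m xs) * (\<integral>\<^sup>+h. f xs h \<partial>forward xs b m)) \<in> borel_measurable (\<Pi>\<^sub>M k\<in>{1..Suc m}. X)"
proof (intro borel_measurable_times_ennreal measurable_compose[OF _ measurable_ennreal] predictive_borel
    nn_integral_measurable_subprob_algebra2[OF f] measurable_prob_algebraD measurable_forward)
  show "\<And>k. k \<in> {1..Suc m} \<Longrightarrow> b k \<in> {1..N}" using b by auto
qed (use m in auto)

text \<open>The density \<open>M1\<close> of the reference value turns the pinned particle into one
  more initial draw, so that all \<open>N\<close> are i.i.d. and the reference is the
  \<open>n\<close>th of them.\<close>

lemma nn_integral_forward_0:
  assumes n: "n \<in> {1..N}"
    and f: "(\<lambda>(y, h). f y h) \<in> borel_measurable (X \<Otimes>\<^sub>M history_space X N 0)"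
  shows "(\<integral>\<^sup>+y. ennreal (M1 y) * (\<integral>\<^sup>+h. f y h \<partial>forward ((\<lambda>_. undefined)(1 := y)) ((\<lambda>_. undefined)(1 := n)) 0) \<partial>X) =
    (\<integral>\<^sup>+x. f (x n) ((\<lambda>k. undefined)(1 := x), \<lambda>k. undefined) \<partial>(\<Pi>\<^sub>M i\<in>{1..N}. density X M1))"
proof -
  let ?init = "\<lambda>x. ((\<lambda>k. undefined)(1 := x), \<lambda>k. undefined) :: (nat \<Rightarrow> nat \<Rightarrow> 'a) \<times> (nat \<Rightarrow> nat \<Rightarrow> nat)"
  let ?H = "history_space X N 0"
  note init[measurable] = measurable_initial_history
  have "(\<integral>\<^sup>+h. f y h \<partial>forward ((\<lambda>_. undefined)(1 := y)) ((\<lambda>_. undefined)(1 := n)) 0) =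
      (\<integral>\<^sup>+x. f y (?init x) \<partial>draw_particles X N n y (\<lambda>i. M1))" if y: "y \<in> space X" for y
  proof -
    have [measurable]: "f y \<in> borel_measurable ?H"
      using f y by measurable
    have "draw_particles X N n y (\<lambda>i. M1) \<in> space (prob_algebra (\<Pi>\<^sub>M i\<in>{1..N}. X))"
      using measurable_space[OF measurable_draw_initial[OF measurable_ident_sets[OF refl]] y] .
    then have sets_D[measurable_cong]: "sets (draw_particles X N n y (\<lambda>i. M1)) = sets (\<Pi>\<^sub>M i\<in>{1..N}. X)"
      by (simp add: space_prob_algebra)
    have "(\<integral>\<^sup>+h. f y h \<partial>forward ((\<lambda>_. undefined)(1 := y)) ((\<lambda>_. undefined)(1 := n)) 0) =
        (\<integral>\<^sup>+h. f y h \<partial>(draw_particles X N n y (\<lambda>i. M1) \<bind> (\<lambda>x. return ?H (?init x))))"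
      by simp
    also have "\<dots> = (\<integral>\<^sup>+x. \<integral>\<^sup>+h. f y h \<partial>return ?H (?init x) \<partial>draw_particles X N n y (\<lambda>i. M1))"
      by (intro nn_integral_bind[where B="?H"]) measurable
    also have "\<dots> = (\<integral>\<^sup>+x. f y (?init x) \<partial>draw_particles X N n y (\<lambda>i. M1))"
      using measurable_space[OF init] unfolding sets_eq_imp_space_eq[OF sets_D, symmetric]
      by (intro nn_integral_cong nn_integral_return) auto
    finally show ?thesis .
  qed
  then have "(\<integral>\<^sup>+y. ennreal (M1 y) * (\<integral>\<^sup>+h. f y h \<partial>forward ((\<lambda>_. undefined)(1 := y)) ((\<lambda>_. undefined)(1 := n)) 0) \<partial>X) =
    (\<integral>\<^sup>+y. ennreal (M1 y) * (\<integral>\<^sup>+x. f y (?init x) \<partial>draw_particles X N n y (\<lambda>i. M1)) \<partial>X)"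
    by (intro nn_integral_cong) simp
  also have "\<dots> = (\<integral>\<^sup>+x. f (x n) (?init x) \<partial>(\<Pi>\<^sub>M i\<in>{1..N}. density X M1))"
  proof (rule nn_integral_draw_particles[OF n])
    note f[measurable]
    show "(\<lambda>(y, x). f y (?init x)) \<in> borel_measurable (X \<Otimes>\<^sub>M (\<Pi>\<^sub>M i\<in>{1..N}. X))"
      by measurable
  qed (use M1_borel M1_density in auto)
  finally show ?thesis .
qed

text \<open>Only the new particles are integrated out; history, ancestors and new reference value
  remain arguments, because their integrals will be reordered.\<close>

definition propagated ::
  "((nat \<Rightarrow> 'a) \<Rightarrow> (nat \<Rightarrow> nat) \<Rightarrow> ((nat \<Rightarrow> nat \<Rightarrow> 'a) \<times> (nat \<Rightarrow> nat \<Rightarrow> nat)) \<Rightarrow> ennreal)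
     \<Rightarrow> nat \<Rightarrow> nat \<Rightarrow> (nat \<Rightarrow> 'a) \<Rightarrow> (nat \<Rightarrow> nat) \<Rightarrow> ((nat \<Rightarrow> nat \<Rightarrow> 'a) \<times> (nat \<Rightarrow> nat \<Rightarrow> nat)) \<Rightarrow> (nat \<Rightarrow> nat) \<Rightarrow> 'a \<Rightarrow> ennreal" where
  "propagated \<Phi> m n xs b h A y =
    (\<integral>\<^sup>+x. \<Phi> (xs(Suc (Suc m) := y)) (b(Suc (Suc m) := n)) (extend_history m h A x)
       \<partial>draw_particles X N n y (\<lambda>i. M (Suc (Suc m)) (fst h (Suc m) (A i))))"

lemma measurable_propagated:
  assumes m: "Suc (Suc m) \<le> T"
    and \<Phi>: "(\<lambda>(xs, h). \<Phi> xs (b(Suc (Suc m) := n)) h)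
      \<in> borel_measurable ((\<Pi>\<^sub>M k\<in>{1..Suc (Suc m)}. X) \<Otimes>\<^sub>M history_space X N (Suc m))"
    and xs: "xs \<in> S \<rightarrow>\<^sub>M (\<Pi>\<^sub>M k\<in>{1..Suc m}. X)" and h: "h \<in> S \<rightarrow>\<^sub>M history_space X N m"
    and A: "A \<in> S \<rightarrow>\<^sub>M index_vectors N" and y: "y \<in> S \<rightarrow>\<^sub>M X"
  shows "(\<lambda>s. propagated \<Phi> m n (xs s) b (h s) (A s) (y s)) \<in> borel_measurable S"
  unfolding propagated_def
proof (rule nn_integral_measurable_subprob_algebra2)
  show "(\<lambda>s. draw_particles X N n (y s) (\<lambda>i. M (Suc (Suc m)) (fst (h s) (Suc m) (A s i))))
    \<in> S \<rightarrow>\<^sub>M subprob_algebra (\<Pi>\<^sub>M i\<in>{1..N}. X)"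
    by (rule measurable_prob_algebraD[OF measurable_draw_transition[OF y h A m]])
  have "(\<lambda>z. ((xs (fst z))(Suc (Suc m) := y (fst z)), extend_history m (h (fst z)) (A (fst z)) (snd z)))
    \<in> S \<Otimes>\<^sub>M (\<Pi>\<^sub>M i\<in>{1..N}. X) \<rightarrow>\<^sub>M (\<Pi>\<^sub>M k\<in>{1..Suc (Suc m)}. X) \<Otimes>\<^sub>M history_space X N (Suc m)"
    by (intro measurable_Pair measurable_path_update measurable_extend_history
        measurable_compose[OF measurable_fst] xs y h A measurable_snd)
  from measurable_compose[OF this \<Phi>]
  show "(\<lambda>(s, x). \<Phi> ((xs s)(Suc (Suc m) := y s)) (b(Suc (Suc m) := n)) (extend_history m (h s) (A s) x))
    \<in> borel_measurable (S \<Otimes>\<^sub>M (\<Pi>\<^sub>M i\<in>{1..N}. X))"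
    by (simp add: case_prod_beta)
qed

lemma measurable_path_component: "f \<in> S \<rightarrow>\<^sub>M (\<Pi>\<^sub>M k\<in>I. X) \<Longrightarrow> k \<in> I \<Longrightarrow> (\<lambda>s. f s k) \<in> S \<rightarrow>\<^sub>M X"
  by (rule measurable_compose[OF _ measurable_component_singleton])

lemma measurable_propagated_density:
  assumes m: "Suc (Suc m) \<le> T"
    and \<Phi>: "(\<lambda>(xs, h). \<Phi> xs (b(Suc (Suc m) := n)) h)
      \<in> borel_measurable ((\<Pi>\<^sub>M k\<in>{1..Suc (Suc m)}. X) \<Otimes>\<^sub>M history_space X N (Suc m))"
    and xs: "xs \<in> S \<rightarrow>\<^sub>M (\<Pi>\<^sub>M k\<in>{1..Suc m}. X)" and h: "h \<in> S \<rightarrow>\<^sub>M history_space X N m"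
    and A: "A \<in> S \<rightarrow>\<^sub>M index_vectors N" and y: "y \<in> S \<rightarrow>\<^sub>M X"
  shows "(\<lambda>s. ennreal (M (Suc (Suc m)) (xs s (Suc m)) (y s)) * propagated \<Phi> m n (xs s) b (h s) (A s) (y s)) \<in> borel_measurable S"
  using m by (intro borel_measurable_times_ennreal measurable_propagated[where \<Phi>=\<Phi> and b=b and n=n and m=m, OF assms]
      measurable_compose[OF M_borel measurable_ennreal] measurable_path_component[OF xs] y) auto

text \<open>The functional at time \<open>m + 1\<close> to which \<open>\<Phi>\<close> at time
  \<open>m + 2\<close> is pulled back. The potential is included because it becomes the weight of
  the reference index. The reference value \<open>y\<close> is integrated inside the ancestor draw,
  where its density meets the draw of the other particles.\<close>

definition step_functional ::
  "((nat \<Rightarrow> 'a) \<Rightarrow> (nat \<Rightarrow> nat) \<Rightarrow> ((nat \<Rightarrow> nat \<Rightarrow> 'a) \<times> (nat \<Rightarrow> nat \<Rightarrow> nat)) \<Rightarrow> ennreal)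
     \<Rightarrow> nat \<Rightarrow> nat \<Rightarrow> (nat \<Rightarrow> 'a) \<Rightarrow> (nat \<Rightarrow> nat) \<Rightarrow> ((nat \<Rightarrow> nat \<Rightarrow> 'a) \<times> (nat \<Rightarrow> nat \<Rightarrow> nat)) \<Rightarrow> ennreal" where
  "step_functional \<Phi> m n xs b h = ennreal (potential (Suc m) xs) *
    (\<integral>\<^sup>+A. \<integral>\<^sup>+y. ennreal (M (Suc (Suc m)) (xs (Suc m)) y) * propagated \<Phi> m n xs b h A y \<partial>X
       \<partial>q (b (Suc m)) n (weights N G1 G (Suc m) (fst h) (snd h)))"

lemma measurable_step_functional:
  assumes m: "Suc (Suc m) \<le> T"
    and b: "b \<in> {1..Suc m} \<rightarrow>\<^sub>E {1..N}" and n: "n \<in> {1..N}"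
    and \<Phi>: "(\<lambda>(xs, h). \<Phi> xs (b(Suc (Suc m) := n)) h)
      \<in> borel_measurable ((\<Pi>\<^sub>M k\<in>{1..Suc (Suc m)}. X) \<Otimes>\<^sub>M history_space X N (Suc m))"
  shows "(\<lambda>(xs, h). step_functional \<Phi> m n xs b h) \<in> borel_measurable ((\<Pi>\<^sub>M k\<in>{1..Suc m}. X) \<Otimes>\<^sub>M history_space X N m)"
  unfolding case_prod_beta step_functional_def
proof (intro borel_measurable_times_ennreal measurable_compose[OF potential_borel measurable_ennreal])
  let ?S = "(\<Pi>\<^sub>M k\<in>{1..Suc m}. X) \<Otimes>\<^sub>M history_space X N m"
  show "(\<lambda>z. \<integral>\<^sup>+A. \<integral>\<^sup>+y. ennreal (M (Suc (Suc m)) (fst z (Suc m)) y) * propagated \<Phi> m n (fst z) b (snd z) A y \<partial>X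
       \<partial>q (b (Suc m)) n (weights N G1 G (Suc m) (fst (snd z)) (snd (snd z)))) \<in> borel_measurable ?S"
  proof (rule nn_integral_measurable_subprob_algebra2)
    have "b (Suc m) \<in> {1..N}" using b by auto
    then show "(\<lambda>z. q (b (Suc m)) n (weights N G1 G (Suc m) (fst (snd z)) (snd (snd z)))) \<in> ?S \<rightarrow>\<^sub>M subprob_algebra (index_vectors N)"
      by (intro measurable_prob_algebraD measurable_resample_step[OF measurable_snd m _ n])
    have "(\<lambda>w. ennreal (M (Suc (Suc m)) (fst (fst (fst w)) (Suc m)) (snd w)) * propagated \<Phi> m n (fst (fst (fst w))) b (snd (fst (fst w))) (snd (fst w)) (snd w))
        \<in> borel_measurable ((?S \<Otimes>\<^sub>M index_vectors N) \<Otimes>\<^sub>M X)"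
      by (rule measurable_propagated_density[where \<Phi>=\<Phi> and b=b and n=n and m=m, OF m \<Phi>]) measurable
    then show "(\<lambda>(z, A). \<integral>\<^sup>+y. ennreal (M (Suc (Suc m)) (fst z (Suc m)) y) * propagated \<Phi> m n (fst z) b (snd z) A y \<partial>X)
        \<in> borel_measurable (?S \<Otimes>\<^sub>M index_vectors N)"
      unfolding case_prod_beta by (intro borel_measurable_nn_integral) (simp add: case_prod_beta)
  qed
qed (use m in \<open>auto intro: measurable_path_component[OF measurable_fst]\<close>)

text \<open>The forward pass up to \<open>m\<close> does not look at the new reference value
  \<open>y\<close>, and the predictive density factors into its predecessor, a potential and a
  transition density. Tonelli's theorem then moves the integral over \<open>y\<close> inside those
  over history and ancestors.\<close>

lemma nn_integral_forward_step:
  assumes m: "Suc (Suc m) \<le> T"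
    and xs: "xs \<in> space (\<Pi>\<^sub>M k\<in>{1..Suc m}. X)"
    and b: "b \<in> {1..Suc m} \<rightarrow>\<^sub>E {1..N}" and n: "n \<in> {1..N}"
    and \<Phi>: "(\<lambda>(xs, h). \<Phi> xs (b(Suc (Suc m) := n)) h)
      \<in> borel_measurable ((\<Pi>\<^sub>M k\<in>{1..Suc (Suc m)}. X) \<Otimes>\<^sub>M history_space X N (Suc m))"
  shows "(\<integral>\<^sup>+y. ennreal (predictive (Suc m) (xs(Suc (Suc m) := y))) *
      (\<integral>\<^sup>+h. \<Phi> (xs(Suc (Suc m) := y)) (b(Suc (Suc m) := n)) h
        \<partial>forward (xs(Suc (Suc m) := y)) (b(Suc (Suc m) := n)) (Suc m)) \<partial>X) =
    ennreal (predictive m xs) * (\<integral>\<^sup>+h. step_functional \<Phi> m n xs b h \<partial>forward xs b m)"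
    (is "?L = _")
proof -
  let ?K = "Suc (Suc m)" and ?H = "history_space X N m"
  let ?F = "forward xs b m" and ?W = "\<lambda>h. weights N G1 G (Suc m) (fst h) (snd h)"
  let ?q = "\<lambda>h. q (b (Suc m)) n (?W h)"
  let ?c = "ennreal (predictive m xs) * ennreal (potential (Suc m) xs)"
  let ?M = "\<lambda>y. ennreal (M ?K (xs (Suc m)) y)"
  have xs_k: "xs k \<in> space X" if "k \<in> {1..Suc m}" for k
    using xs that by (auto simp: space_PiM)
  have b_m: "b (Suc m) \<in> {1..N}" using b by auto
  have F: "?F \<in> space (prob_algebra ?H)"
    using m xs b by (intro prob_forward) auto
  then have sets_F[measurable_cong]: "sets ?F = sets ?H"
    by (simp add: space_prob_algebra)
  note space_F = sets_eq_imp_space_eq[OF sets_F]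
  have q: "?q h \<in> space (prob_algebra (index_vectors N))" if "h \<in> space ?H" for h
    using m that by (intro measurable_space[OF measurable_q[OF b_m n]] space_weights) auto
  have forward_y: "(\<integral>\<^sup>+h. \<Phi> (xs(?K := y)) (b(?K := n)) h \<partial>forward (xs(?K := y)) (b(?K := n)) (Suc m)) =
      (\<integral>\<^sup>+h. \<integral>\<^sup>+A. propagated \<Phi> m n xs b h A y \<partial>?q h \<partial>?F)" if y: "y \<in> space X" for y
  proof -
    have "(xs(?K := y)) \<in> space (\<Pi>\<^sub>M k\<in>{1..?K}. X)"
      using measurable_space[OF measurable_path_update[OF measurable_const measurable_ident_sets[OF refl]], of xs "Suc m" X y] xs y
      by simp
    with \<Phi> have \<Phi>_y: "\<Phi> (xs(?K := y)) (b(?K := n)) \<in> borel_measurable (history_space X N (Suc m))"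
      by (auto dest: measurable_Pair2)
    have "forward (xs(?K := y)) (b(?K := n)) (Suc m) = ?F \<bind> particle_step m (b (Suc m)) n y"
      unfolding forward_Suc using forward_cong[of m "xs(?K := y)" xs "b(?K := n)" b] by simp
    moreover have "particle_step m (b (Suc m)) n y \<in> ?H \<rightarrow>\<^sub>M prob_algebra (history_space X N (Suc m))"
      using y measurable_particle_step[OF measurable_const measurable_ident_sets[OF refl] m b_m n] by simp
    ultimately have "(\<integral>\<^sup>+h. \<Phi> (xs(?K := y)) (b(?K := n)) h \<partial>forward (xs(?K := y)) (b(?K := n)) (Suc m)) =
      (\<integral>\<^sup>+h. \<integral>\<^sup>+h'. \<Phi> (xs(?K := y)) (b(?K := n)) h' \<partial>particle_step m (b (Suc m)) n y h \<partial>?F)"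
      by (simp add: nn_integral_bind[OF \<Phi>_y] measurable_prob_algebraD measurable_cong_sets[OF sets_F refl] del: cpf_forward.simps)
    also have "\<dots> = (\<integral>\<^sup>+h. \<integral>\<^sup>+A. propagated \<Phi> m n xs b h A y \<partial>?q h \<partial>?F)"
      unfolding propagated_def by (intro nn_integral_cong nn_integral_particle_step y m b_m n \<Phi>_y) (simp add: space_F)
    finally show ?thesis .
  qed
  \<comment> \<open>The domain \<open>S\<close> is generic because the exchanges below use this on
    products in several orders, and also with the history frozen.\<close>
  have density: "(\<lambda>s. ?M (y s) * propagated \<Phi> m n xs b (h s) (A s) (y s)) \<in> borel_measurable S"
    if "h \<in> S \<rightarrow>\<^sub>M ?H" "A \<in> S \<rightarrow>\<^sub>M index_vectors N" "y \<in> S \<rightarrow>\<^sub>M X" for S :: "'z measure" and h A y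
    using xs by (intro measurable_propagated_density[where \<Phi>=\<Phi> and b=b and n=n and m=m and xs="\<lambda>_. xs", OF m \<Phi>] that) simp
  have prop_borel: "(\<lambda>s. propagated \<Phi> m n xs b (h s) (A s) (y s)) \<in> borel_measurable S"
    if "h \<in> S \<rightarrow>\<^sub>M ?H" "A \<in> S \<rightarrow>\<^sub>M index_vectors N" "y \<in> S \<rightarrow>\<^sub>M X" for S :: "'z measure" and h A y
    using xs by (intro measurable_propagated[where \<Phi>=\<Phi> and b=b and n=n and m=m and xs="\<lambda>_. xs", OF m \<Phi>] that) simp
  have resample: "(\<lambda>s. ?q (h s)) \<in> S \<rightarrow>\<^sub>M subprob_algebra (index_vectors N)"
    if "h \<in> S \<rightarrow>\<^sub>M ?H" for S :: "'z measure" and h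
    by (intro measurable_prob_algebraD measurable_resample_step that m b_m n)
  have inner: "(\<lambda>s. \<integral>\<^sup>+A. propagated \<Phi> m n xs b (h s) A (y s) \<partial>?q (h s)) \<in> borel_measurable S"
    if "h \<in> S \<rightarrow>\<^sub>M ?H" "y \<in> S \<rightarrow>\<^sub>M X" for S :: "'z measure" and h y
  proof (rule nn_integral_measurable_subprob_algebra2[OF _ resample[OF that(1)]])
    show "(\<lambda>(s, A). propagated \<Phi> m n xs b (h s) A (y s)) \<in> borel_measurable (S \<Otimes>\<^sub>M index_vectors N)"
      unfolding case_prod_beta
      by (intro prop_borel measurable_compose[OF measurable_fst that(1)] measurable_compose[OF measurable_fst that(2)] measurable_snd)
  qed
  have pull: "?M y * (\<integral>\<^sup>+h. \<integral>\<^sup>+A. propagated \<Phi> m n xs b h A y \<partial>?q h \<partial>?F) =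
      (\<integral>\<^sup>+h. \<integral>\<^sup>+A. ?M y * propagated \<Phi> m n xs b h A y \<partial>?q h \<partial>?F)" if y: "y \<in> space X" for y
  proof -
    have "(\<lambda>h. \<integral>\<^sup>+A. propagated \<Phi> m n xs b h A y \<partial>?q h) \<in> borel_measurable ?F"
      using y inner[OF measurable_ident_sets[OF refl] measurable_const] by (simp add: measurable_cong_sets[OF sets_F refl])
    then have "?M y * (\<integral>\<^sup>+h. \<integral>\<^sup>+A. propagated \<Phi> m n xs b h A y \<partial>?q h \<partial>?F) =
        (\<integral>\<^sup>+h. ?M y * (\<integral>\<^sup>+A. propagated \<Phi> m n xs b h A y \<partial>?q h) \<partial>?F)"
      by (rule nn_integral_cmult[symmetric])
    also have "\<dots> = (\<integral>\<^sup>+h. \<integral>\<^sup>+A. ?M y * propagated \<Phi> m n xs b h A y \<partial>?q h \<partial>?F)"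
    proof (intro nn_integral_cong nn_integral_cmult[symmetric])
      fix h assume "h \<in> space ?F"
      then have h: "h \<in> space ?H" by (simp add: space_F)
      then have "sets (?q h) = sets (index_vectors N)"
        using q by (simp add: space_prob_algebra)
      then show "(\<lambda>A. propagated \<Phi> m n xs b h A y) \<in> borel_measurable (?q h)"
        using prop_borel[OF measurable_const[OF h] measurable_ident_sets measurable_const[OF y]] by blast
    qed
    finally show ?thesis .
  qed
  have "?L = (\<integral>\<^sup>+y. ?c * (?M y * (\<integral>\<^sup>+h. \<integral>\<^sup>+A. propagated \<Phi> m n xs b h A y \<partial>?q h \<partial>?F)) \<partial>X)"
  proof (rule nn_integral_cong)
    fix y assume y: "y \<in> space X"
    have "predictive (Suc m) (xs(?K := y)) = predictive m xs * potential (Suc m) xs * M ?K (xs (Suc m)) y"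
      using predictive_cong[of m "xs(?K := y)" xs] potential_cong[of "Suc m" "xs(?K := y)" xs] by simp
    moreover have "0 \<le> predictive m xs" "0 \<le> potential (Suc m) xs" "0 \<le> M ?K (xs (Suc m)) y"
      using m y xs_k by (auto intro!: predictive_nonneg potential_nonneg M_nonneg)
    ultimately have "ennreal (predictive (Suc m) (xs(?K := y))) = ?c * ?M y"
      by (simp add: ennreal_mult del: predictive.simps)
    then show "ennreal (predictive (Suc m) (xs(?K := y))) *
      (\<integral>\<^sup>+h. \<Phi> (xs(?K := y)) (b(?K := n)) h \<partial>forward (xs(?K := y)) (b(?K := n)) (Suc m)) =
      ?c * (?M y * (\<integral>\<^sup>+h. \<integral>\<^sup>+A. propagated \<Phi> m n xs b h A y \<partial>?q h \<partial>?F))"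
      unfolding forward_y[OF y] by (simp only: mult.assoc)
  qed
  also have "\<dots> = (\<integral>\<^sup>+y. ?c * (\<integral>\<^sup>+h. \<integral>\<^sup>+A. ?M y * propagated \<Phi> m n xs b h A y \<partial>?q h \<partial>?F) \<partial>X)"
    by (intro nn_integral_cong) (simp only: pull)
  also have "\<dots> = ?c * (\<integral>\<^sup>+y. \<integral>\<^sup>+h. \<integral>\<^sup>+A. ?M y * propagated \<Phi> m n xs b h A y \<partial>?q h \<partial>?F \<partial>X)"
  proof (rule nn_integral_cmult)
    have "(\<lambda>(z, A). ?M (fst z) * propagated \<Phi> m n xs b (snd z) A (fst z)) \<in> borel_measurable ((X \<Otimes>\<^sub>M ?H) \<Otimes>\<^sub>M index_vectors N)"
      unfolding case_prod_beta by (intro density) measurable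
    then have "(\<lambda>z. \<integral>\<^sup>+A. ?M (fst z) * propagated \<Phi> m n xs b (snd z) A (fst z) \<partial>?q (snd z)) \<in> borel_measurable (X \<Otimes>\<^sub>M ?H)"
      by (rule nn_integral_measurable_subprob_algebra2) (rule resample[OF measurable_snd])
    then have "(\<lambda>(y, h). \<integral>\<^sup>+A. ?M y * propagated \<Phi> m n xs b h A y \<partial>?q h) \<in> borel_measurable (X \<Otimes>\<^sub>M ?H)"
      by (simp add: case_prod_beta)
    moreover have "(\<lambda>y. ?F) \<in> X \<rightarrow>\<^sub>M subprob_algebra ?H"
      using measurable_prob_algebraD[OF measurable_const[OF F]] .
    ultimately show "(\<lambda>y. \<integral>\<^sup>+h. \<integral>\<^sup>+A. ?M y * propagated \<Phi> m n xs b h A y \<partial>?q h \<partial>?F) \<in> borel_measurable X"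
      by (rule nn_integral_measurable_subprob_algebra2)
  qed
  \<comment> \<open>The integral over \<open>y\<close> passes the history here and the ancestors
    next; the laws of both are independent of \<open>y\<close>.\<close>
  also have "(\<integral>\<^sup>+y. \<integral>\<^sup>+h. \<integral>\<^sup>+A. ?M y * propagated \<Phi> m n xs b h A y \<partial>?q h \<partial>?F \<partial>X) =
      (\<integral>\<^sup>+h. \<integral>\<^sup>+y. \<integral>\<^sup>+A. ?M y * propagated \<Phi> m n xs b h A y \<partial>?q h \<partial>X \<partial>?F)"
  proof (rule nn_integral_swap_kernel[OF F])
    have "(\<lambda>(z, A). ?M (fst z) * propagated \<Phi> m n xs b (snd z) A (fst z)) \<in> borel_measurable ((X \<Otimes>\<^sub>M ?H) \<Otimes>\<^sub>M index_vectors N)"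
      unfolding case_prod_beta by (intro density) measurable
    then have "(\<lambda>z. \<integral>\<^sup>+A. ?M (fst z) * propagated \<Phi> m n xs b (snd z) A (fst z) \<partial>?q (snd z)) \<in> borel_measurable (X \<Otimes>\<^sub>M ?H)"
      by (rule nn_integral_measurable_subprob_algebra2) (rule resample[OF measurable_snd])
    then show "(\<lambda>(y, h). \<integral>\<^sup>+A. ?M y * propagated \<Phi> m n xs b h A y \<partial>?q h) \<in> borel_measurable (X \<Otimes>\<^sub>M ?H)"
      by (simp add: case_prod_beta)
  qed
  also have "\<dots> = (\<integral>\<^sup>+h. \<integral>\<^sup>+A. \<integral>\<^sup>+y. ?M y * propagated \<Phi> m n xs b h A y \<partial>X \<partial>?q h \<partial>?F)"
  proof (intro nn_integral_cong nn_integral_swap_kernel)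
    fix h assume "h \<in> space ?F"
    then have h: "h \<in> space ?H" by (simp add: space_F)
    show "?q h \<in> space (prob_algebra (index_vectors N))" by (rule q[OF h])
    show "(\<lambda>(y, A). ?M y * propagated \<Phi> m n xs b h A y) \<in> borel_measurable (X \<Otimes>\<^sub>M index_vectors N)"
      unfolding case_prod_beta by (intro density measurable_const h) measurable
  qed
  also have "?c * \<dots> = ennreal (predictive m xs) * (\<integral>\<^sup>+h. step_functional \<Phi> m n xs b h \<partial>?F)"
    unfolding step_functional_def mult.assoc
  proof (subst nn_integral_cmult)
    have "(\<lambda>w. ?M (snd w) * propagated \<Phi> m n xs b (fst (fst w)) (snd (fst w)) (snd w)) \<in> borel_measurable ((?H \<Otimes>\<^sub>M index_vectors N) \<Otimes>\<^sub>M X)"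
      by (rule density) measurable
    then have "(\<lambda>(h, A). \<integral>\<^sup>+y. ?M y * propagated \<Phi> m n xs b h A y \<partial>X) \<in> borel_measurable (?H \<Otimes>\<^sub>M index_vectors N)"
      unfolding case_prod_beta by (intro borel_measurable_nn_integral) (simp add: case_prod_beta)
    then have "(\<lambda>h. \<integral>\<^sup>+A. \<integral>\<^sup>+y. ?M y * propagated \<Phi> m n xs b h A y \<partial>X \<partial>?q h) \<in> borel_measurable ?H"
      by (rule nn_integral_measurable_subprob_algebra2) (rule resample[OF measurable_ident_sets[OF refl]])
    then show "(\<lambda>h. \<integral>\<^sup>+A. \<integral>\<^sup>+y. ?M y * propagated \<Phi> m n xs b h A y \<partial>X \<partial>?q h) \<in> borel_measurable ?F"
      by (simp add: measurable_cong_sets[OF sets_F refl])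
  qed simp
  finally show ?thesis .
qed


lemma lineage_in:
  assumes "h \<in> space (history_space X N m)" "j \<in> {1..N}"
  shows "lineage m h j \<in> {1..Suc m} \<rightarrow>\<^sub>E {1..N}"
  using measurable_space[OF measurable_lineage[OF measurable_ident_sets[OF refl] assms(2)] assms(1)] by simp

lemma lineage_path_in:
  assumes "h \<in> space (history_space X N m)" "j \<in> {1..N}"
  shows "lineage_path m h j \<in> space (\<Pi>\<^sub>M k\<in>{1..Suc m}. X)"
  using measurable_space[OF measurable_lineage_path[OF measurable_ident_sets[OF refl] assms(2)] assms(1)] .

text \<open>Both cancellations in one step. On lineage \<open>j\<close> the potential is the weight
  of \<open>j\<close>, so summing over \<open>j\<close> replaces conditional by unconditional
  resampling and puts \<open>A n\<close> for \<open>j\<close>. The reference value then has the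
  density of an offspring of \<open>A n\<close>, which is that of particle \<open>n\<close>, so the
  new particles become independent. What remains is one lineage of the extended history for each
  \<open>n\<close>.\<close>

lemma sum_step_functional:
  assumes m: "Suc (Suc m) \<le> T" and h: "h \<in> space (history_space X N m)"
    and \<Phi>: "\<And>b. b \<in> {1..Suc (Suc m)} \<rightarrow>\<^sub>E {1..N} \<Longrightarrow> (\<lambda>(xs, h). \<Phi> xs b h)
      \<in> borel_measurable ((\<Pi>\<^sub>M k\<in>{1..Suc (Suc m)}. X) \<Otimes>\<^sub>M history_space X N (Suc m))"
  shows "(\<Sum>j=1..N. \<Sum>n=1..N. step_functional \<Phi> m n (lineage_path m h j) (lineage m h j) h) =
    ennreal (\<Sum>i=1..N. weights N G1 G (Suc m) (fst h) (snd h) i) *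
    (\<integral>\<^sup>+A. \<integral>\<^sup>+x. (\<Sum>n=1..N. \<Phi> (lineage_path (Suc m) (extend_history m h A x) n)
        (lineage (Suc m) (extend_history m h A x) n) (extend_history m h A x))
      \<partial>(\<Pi>\<^sub>M i\<in>{1..N}. density X (M (Suc (Suc m)) (fst h (Suc m) (A i))))
      \<partial>r (weights N G1 G (Suc m) (fst h) (snd h)))"
proof -
  let ?K = "Suc (Suc m)" and ?W = "weights N G1 G (Suc m) (fst h) (snd h)"
  let ?D = "\<lambda>A. \<Pi>\<^sub>M i\<in>{1..N}. density X (M (Suc (Suc m)) (fst h (Suc m) (A i)))"
  let ?\<Phi> = "\<lambda>A x n. \<Phi> (lineage_path (Suc m) (extend_history m h A x) n)
        (lineage (Suc m) (extend_history m h A x) n) (extend_history m h A x)"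
  \<comment> \<open>\<open>j\<close> is kept apart from \<open>A\<close>: for fixed \<open>n\<close>
    this is the integrand \<open>f p A\<close> of \<open>nn_integral_conditional_resampling\<close>,
    to be read at \<open>j = A n\<close> afterwards.\<close>
  define F where "F n j A = (\<integral>\<^sup>+y. ennreal (M ?K (fst h (Suc m) j) y) *
    propagated \<Phi> m n (lineage_path m h j) (lineage m h j) h A y \<partial>X)" for n j A
  have W: "?W \<in> space (weight_space N)"
    using m by (intro space_weights[OF h]) simp
  have sets_rW[measurable_cong]: "sets (r ?W) = sets (index_vectors N)" by (rule sets_r[OF W])
  have x_in: "fst h (Suc m) j \<in> space X" if "j \<in> {1..N}" for j
    using measurable_space[OF measurable_history_particle[OF measurable_ident_sets[OF refl] _ that] h, of "Suc m"] by simp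
  have sets_D: "sets (?D A) = sets (\<Pi>\<^sub>M i\<in>{1..N}. X)" for A
    by (intro sets_PiM_cong) auto
  have \<Phi>_m: "(\<lambda>(y, x). \<Phi> ((lineage_path m h (A n))(?K := y)) ((lineage m h (A n))(?K := n)) (extend_history m h A x))
      \<in> borel_measurable (X \<Otimes>\<^sub>M (\<Pi>\<^sub>M i\<in>{1..N}. X))" if A: "A \<in> {1..N} \<rightarrow>\<^sub>E {1..N}" and n: "n \<in> {1..N}" for A n
  proof -
    have An: "A n \<in> {1..N}" using A n by auto
    have "(lineage m h (A n))(?K := n) \<in> {1..?K} \<rightarrow>\<^sub>E {1..N}"
      using lineage_in[OF h An] n by (auto simp: PiE_iff extensional_def)
    note \<Phi>' = \<Phi>[OF this]
    have "(\<lambda>z. ((lineage_path m h (A n))(?K := fst z), extend_history m h A (snd z)))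
      \<in> X \<Otimes>\<^sub>M (\<Pi>\<^sub>M i\<in>{1..N}. X) \<rightarrow>\<^sub>M (\<Pi>\<^sub>M k\<in>{1..?K}. X) \<Otimes>\<^sub>M history_space X N (Suc m)"
      using A by (intro measurable_Pair measurable_path_update measurable_extend_history measurable_fst measurable_snd
          measurable_const lineage_path_in[OF h An] h) (simp add: index_vectors_def)
    from measurable_compose[OF this \<Phi>'] show ?thesis
      by (simp add: case_prod_beta)
  qed
  \<comment> \<open>For \<open>j = A n\<close> the density of the reference value is the
    \<open>n\<close>th proposal density, exactly the match that
    \<open>nn_integral_draw_particles\<close> requires.\<close>
  have F_eq: "F n (A n) A = (\<integral>\<^sup>+x. ?\<Phi> A x n \<partial>?D A)" if A: "A \<in> {1..N} \<rightarrow>\<^sub>E {1..N}" and n: "n \<in> {1..N}" for A n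
    unfolding F_def propagated_def lineage_extend_history lineage_path_extend_history
    using n A m x_in
    by (intro nn_integral_draw_particles[OF n, where D="\<lambda>i. M ?K (fst h (Suc m) (A i))"] \<Phi>_m M_density M_borel measurable_const)
       (auto intro!: x_in PiE_mem[OF A])
  have "(\<Sum>j=1..N. \<Sum>n=1..N. step_functional \<Phi> m n (lineage_path m h j) (lineage m h j) h) =
      (\<Sum>j=1..N. \<Sum>n=1..N. ennreal (?W j) * (\<integral>\<^sup>+A. F n j A \<partial>q j n ?W))"
    unfolding step_functional_def F_def lineage_last lineage_path_last
    by (intro sum.cong refl) (simp add: weights_eq_potential_lineage)
  \<comment> \<open>The conditional law depends on the next index \<open>n\<close>, so the reference
    index \<open>j\<close> is summed out for each \<open>n\<close> separately.\<close>
  also have "\<dots> = (\<Sum>n=1..N. \<Sum>j=1..N. ennreal (?W j) * (\<integral>\<^sup>+A. F n j A \<partial>q j n ?W))"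
    by (rule sum.swap)
  also have "\<dots> = (\<Sum>n=1..N. ennreal (\<Sum>i=1..N. ?W i) * (\<integral>\<^sup>+A. F n (A n) A \<partial>r ?W))"
    by (intro sum.cong refl nn_integral_conditional_resampling[OF W])
  also have "\<dots> = ennreal (\<Sum>i=1..N. ?W i) * (\<integral>\<^sup>+A. (\<Sum>n=1..N. F n (A n) A) \<partial>r ?W)"
  proof (subst nn_integral_sum)
    show "(\<lambda>A. F n (A n) A) \<in> borel_measurable (r ?W)" for n
      by (simp add: measurable_cong_sets[OF sets_rW refl] index_vectors_def)
  qed (simp add: sum_distrib_left)
  also have "(\<integral>\<^sup>+A. (\<Sum>n=1..N. F n (A n) A) \<partial>r ?W) = (\<integral>\<^sup>+A. \<integral>\<^sup>+x. (\<Sum>n=1..N. ?\<Phi> A x n) \<partial>?D A \<partial>r ?W)"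
  proof (rule nn_integral_cong)
    fix A assume "A \<in> space (r ?W)"
    then have A: "A \<in> {1..N} \<rightarrow>\<^sub>E {1..N}"
      using sets_eq_imp_space_eq[OF sets_rW] by (simp add: index_vectors_def)
    have "(\<integral>\<^sup>+x. (\<Sum>n=1..N. ?\<Phi> A x n) \<partial>?D A) = (\<Sum>n=1..N. \<integral>\<^sup>+x. ?\<Phi> A x n \<partial>?D A)"
    proof (rule nn_integral_sum)
      fix n assume n: "n \<in> {1..N}"
      have "(\<lambda>x. (x n, x)) \<in> (\<Pi>\<^sub>M i\<in>{1..N}. X) \<rightarrow>\<^sub>M X \<Otimes>\<^sub>M (\<Pi>\<^sub>M i\<in>{1..N}. X)"
        using n by measurable
      from measurable_compose[OF this \<Phi>_m[OF A n]] show "(\<lambda>x. ?\<Phi> A x n) \<in> borel_measurable (?D A)"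
        unfolding measurable_cong_sets[OF sets_D refl] lineage_extend_history lineage_path_extend_history by simp
    qed
    then show "(\<Sum>n=1..N. F n (A n) A) = (\<integral>\<^sup>+x. (\<Sum>n=1..N. ?\<Phi> A x n) \<partial>?D A)"
      using F_eq[OF A] by simp
  qed
  finally show ?thesis .
qed

text \<open>Induction on time; \<open>\<Phi>\<close> is general because the hypothesis is applied to
  a pulled-back functional, which depends on the history even if \<open>\<Phi>\<close> does not. The
  sum over \<open>b\<close> is the uniform law of the reference indices up to its constant.\<close>

lemma forward_particle_integral:
  assumes "Suc m \<le> T"
    and "\<And>b. b \<in> {1..Suc m} \<rightarrow>\<^sub>E {1..N} \<Longrightarrow> (\<lambda>(xs, h). \<Phi> xs b h)
      \<in> borel_measurable ((\<Pi>\<^sub>M k\<in>{1..Suc m}. X) \<Otimes>\<^sub>M history_space X N m)"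
  shows "(\<Sum>b\<in>{1..Suc m} \<rightarrow>\<^sub>E {1..N}. \<integral>\<^sup>+xs. ennreal (predictive m xs) *
      (\<integral>\<^sup>+h. \<Phi> xs b h \<partial>forward xs b m) \<partial>(\<Pi>\<^sub>M k\<in>{1..Suc m}. X)) =
    particle_integral m (\<lambda>h. \<Sum>j=1..N. \<Phi> (lineage_path m h j) (lineage m h j) h)"
  using assms
proof (induction m arbitrary: \<Phi>)
  case 0
  let ?u = "\<lambda>_. undefined :: 'a" and ?v = "\<lambda>_. undefined :: nat"
  let ?init = "\<lambda>x. ((\<lambda>k. undefined)(1 := x), \<lambda>k. undefined) :: (nat \<Rightarrow> nat \<Rightarrow> 'a) \<times> (nat \<Rightarrow> nat \<Rightarrow> nat)"
  have one: "{1..Suc 0} = insert 1 {}" by auto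
  have v_in: "?v(1 := n) \<in> {1..Suc 0} \<rightarrow>\<^sub>E {1..N}" if "n \<in> {1..N}" for n
    using that by (auto simp: PiE_iff extensional_def)
  have u_m: "(\<lambda>y. ?u(1 := y)) \<in> X \<rightarrow>\<^sub>M (\<Pi>\<^sub>M k\<in>{1..Suc 0}. X)"
    by (rule measurable_fun_upd[where J="{}"]) auto
  have \<Phi>_m: "(\<lambda>(y, h). \<Phi> (?u(1 := y)) (?v(1 := n)) h) \<in> borel_measurable (X \<Otimes>\<^sub>M history_space X N 0)"
    if n: "n \<in> {1..N}" for n
  proof -
    have "(\<lambda>z. (?u(1 := fst z), snd z)) \<in> X \<Otimes>\<^sub>M history_space X N 0 \<rightarrow>\<^sub>M (\<Pi>\<^sub>M k\<in>{1..Suc 0}. X) \<Otimes>\<^sub>M history_space X N 0"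
      by (intro measurable_Pair measurable_compose[OF measurable_fst u_m] measurable_snd)
    from measurable_compose[OF this 0(2)[OF v_in[OF n]]] show ?thesis
      by (simp only: case_prod_beta' fst_conv snd_conv)
  qed
  have path_init: "lineage_path 0 (?init x) n = ?u(1 := x n)" "lineage 0 (?init x) n = ?v(1 := n)" for x :: "nat \<Rightarrow> 'a" and n
    by (auto simp: lineage_path_def lineage_def fun_eq_iff)
  \<comment> \<open>The product over no times is the point mass at the everywhere undefined
    path.\<close>
  have empty_integral: "(\<integral>\<^sup>+xs. g xs \<partial>(\<Pi>\<^sub>M k\<in>{}. X)) = g ?u" for g :: "(nat \<Rightarrow> 'a) \<Rightarrow> ennreal"
    by (simp add: PiM_empty nn_integral_count_space_finite)
  have "(\<Sum>b\<in>{1..Suc 0} \<rightarrow>\<^sub>E {1..N}. \<integral>\<^sup>+xs. ennreal (predictive 0 xs) *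
      (\<integral>\<^sup>+h. \<Phi> xs b h \<partial>forward xs b 0) \<partial>(\<Pi>\<^sub>M k\<in>{1..Suc 0}. X)) =
    (\<Sum>n=1..N. \<integral>\<^sup>+xs. ennreal (predictive 0 xs) *
      (\<integral>\<^sup>+h. \<Phi> xs (?v(1 := n)) h \<partial>forward xs (?v(1 := n)) 0) \<partial>(\<Pi>\<^sub>M k\<in>{1..Suc 0}. X))"
  proof -
    have "(\<Sum>b\<in>{?v}. f b) = f ?v" for f :: "(nat \<Rightarrow> nat) \<Rightarrow> ennreal" by simp
    then show ?thesis
      unfolding one by (subst sum_PiE_insert) (simp_all only: PiE_empty_domain empty_iff not_False_eq_True)
  qed
  also have "\<dots> = (\<Sum>n=1..N. \<integral>\<^sup>+x. \<Phi> (?u(1 := x n)) (?v(1 := n)) (?init x) \<partial>(\<Pi>\<^sub>M i\<in>{1..N}. density X M1))"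
  proof (rule sum.cong[OF refl])
    fix n assume n: "n \<in> {1..N}"
    let ?f = "\<lambda>xs. ennreal (predictive 0 xs) * (\<integral>\<^sup>+h. \<Phi> xs (?v(1 := n)) h \<partial>forward xs (?v(1 := n)) 0)"
    have "?f \<in> borel_measurable (\<Pi>\<^sub>M k\<in>{1..Suc 0}. X)"
      using 0 v_in[OF n] by (intro measurable_forward_integral) auto
    then have "integral\<^sup>N (\<Pi>\<^sub>M k\<in>{1..Suc 0}. X) ?f = (\<integral>\<^sup>+xs. \<integral>\<^sup>+y. ?f (xs(1 := y)) \<partial>X \<partial>(\<Pi>\<^sub>M k\<in>{}. X))"
      unfolding one by (rule nn_integral_path_insert[rotated 2]) auto
    also have "\<dots> = (\<integral>\<^sup>+y. ?f (?u(1 := y)) \<partial>X)"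
      by (rule empty_integral)
    also have "\<dots> = (\<integral>\<^sup>+x. \<Phi> (?u(1 := x n)) (?v(1 := n)) (?init x) \<partial>(\<Pi>\<^sub>M i\<in>{1..N}. density X M1))"
      unfolding predictive.simps fun_upd_same by (rule nn_integral_forward_0[OF n \<Phi>_m[OF n]])
    finally show "integral\<^sup>N (\<Pi>\<^sub>M k\<in>{1..Suc 0}. X) ?f = \<dots>" .
  qed
  also have "\<dots> = (\<integral>\<^sup>+x. (\<Sum>n=1..N. \<Phi> (?u(1 := x n)) (?v(1 := n)) (?init x)) \<partial>(\<Pi>\<^sub>M i\<in>{1..N}. density X M1))"
  proof (rule nn_integral_sum[symmetric])
    fix n assume n: "n \<in> {1..N}"
    have "(\<lambda>x. (x n, ?init x)) \<in> (\<Pi>\<^sub>M i\<in>{1..N}. X) \<rightarrow>\<^sub>M X \<Otimes>\<^sub>M history_space X N 0"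
      using n by (intro measurable_Pair measurable_initial_history) auto
    from measurable_compose[OF this \<Phi>_m[OF n]]
    have "(\<lambda>x. \<Phi> (?u(1 := x n)) (?v(1 := n)) (?init x)) \<in> borel_measurable (\<Pi>\<^sub>M i\<in>{1..N}. X)"
      by simp
    moreover have sets_eq: "sets (\<Pi>\<^sub>M i\<in>{1..N}. density X M1) = sets (\<Pi>\<^sub>M i\<in>{1..N}. X)"
      by (intro sets_PiM_cong) auto
    ultimately show "(\<lambda>x. \<Phi> (?u(1 := x n)) (?v(1 := n)) (?init x)) \<in> borel_measurable (\<Pi>\<^sub>M i\<in>{1..N}. density X M1)"
      by (simp only: measurable_cong_sets[OF sets_eq refl])
  qed
  also have "\<dots> = particle_integral 0 (\<lambda>h. \<Sum>j=1..N. \<Phi> (lineage_path 0 h j) (lineage 0 h j) h)"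
    by (simp only: particle_integral.simps path_init)
  finally show ?case .
next
  case (Suc m)
  let ?K = "Suc (Suc m)"
  have upto: "{1..?K} = insert ?K {1..Suc m}" by auto
  have upd_in: "b(?K := n) \<in> {1..?K} \<rightarrow>\<^sub>E {1..N}" if "b \<in> {1..Suc m} \<rightarrow>\<^sub>E {1..N}" "n \<in> {1..N}" for b n
    using that by (auto simp: PiE_iff extensional_def)
  have step_m: "(\<lambda>(xs, h). step_functional \<Phi> m n xs b h) \<in> borel_measurable ((\<Pi>\<^sub>M k\<in>{1..Suc m}. X) \<Otimes>\<^sub>M history_space X N m)"
    if b: "b \<in> {1..Suc m} \<rightarrow>\<^sub>E {1..N}" and n: "n \<in> {1..N}" for b n
    by (rule measurable_step_functional[where \<Phi>=\<Phi> and b=b and n=n, OF Suc.prems(1) b n Suc.prems(2)[OF upd_in[OF b n]]])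
  \<comment> \<open>The hypothesis at \<open>m\<close> sums over indices up to time
    \<open>m + 1\<close> only; the index of time \<open>m + 2\<close> is absorbed into the
    functional.\<close>
  define S where "S xs b h = (\<Sum>n=1..N. step_functional \<Phi> m n xs b h)" for xs b h
  have "(\<Sum>b\<in>{1..?K} \<rightarrow>\<^sub>E {1..N}. \<integral>\<^sup>+xs. ennreal (predictive (Suc m) xs) *
      (\<integral>\<^sup>+h. \<Phi> xs b h \<partial>forward xs b (Suc m)) \<partial>(\<Pi>\<^sub>M k\<in>{1..?K}. X)) =
    (\<Sum>b\<in>{1..Suc m} \<rightarrow>\<^sub>E {1..N}. \<Sum>n=1..N. \<integral>\<^sup>+xs. ennreal (predictive (Suc m) xs) *
      (\<integral>\<^sup>+h. \<Phi> xs (b(?K := n)) h \<partial>forward xs (b(?K := n)) (Suc m)) \<partial>(\<Pi>\<^sub>M k\<in>{1..?K}. X))"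
    unfolding upto by (rule sum_PiE_insert) simp
  also have "\<dots> = (\<Sum>b\<in>{1..Suc m} \<rightarrow>\<^sub>E {1..N}. \<Sum>n=1..N. \<integral>\<^sup>+xs. ennreal (predictive m xs) *
      (\<integral>\<^sup>+h. step_functional \<Phi> m n xs b h \<partial>forward xs b m) \<partial>(\<Pi>\<^sub>M k\<in>{1..Suc m}. X))"
  proof (intro sum.cong refl)
    fix b n assume b: "b \<in> {1..Suc m} \<rightarrow>\<^sub>E {1..N}" and n: "n \<in> {1..N}"
    let ?f = "\<lambda>xs. ennreal (predictive (Suc m) xs) * (\<integral>\<^sup>+h. \<Phi> xs (b(?K := n)) h \<partial>forward xs (b(?K := n)) (Suc m))"
    have "?f \<in> borel_measurable (\<Pi>\<^sub>M k\<in>{1..?K}. X)"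
      using Suc.prems upd_in[OF b n] by (intro measurable_forward_integral) auto
    then have "integral\<^sup>N (\<Pi>\<^sub>M k\<in>{1..?K}. X) ?f = (\<integral>\<^sup>+xs. \<integral>\<^sup>+y. ?f (xs(?K := y)) \<partial>X \<partial>(\<Pi>\<^sub>M k\<in>{1..Suc m}. X))"
      unfolding upto by (rule nn_integral_path_insert[rotated 2]) auto
    also have "\<dots> = (\<integral>\<^sup>+xs. ennreal (predictive m xs) *
      (\<integral>\<^sup>+h. step_functional \<Phi> m n xs b h \<partial>forward xs b m) \<partial>(\<Pi>\<^sub>M k\<in>{1..Suc m}. X))"
      by (intro nn_integral_cong nn_integral_forward_step[where \<Phi>=\<Phi> and b=b and n=n] Suc.prems b n upd_in)
    finally show "integral\<^sup>N (\<Pi>\<^sub>M k\<in>{1..?K}. X) ?f = \<dots>" .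
  qed
  also have "\<dots> = (\<Sum>b\<in>{1..Suc m} \<rightarrow>\<^sub>E {1..N}. \<integral>\<^sup>+xs. ennreal (predictive m xs) *
      (\<integral>\<^sup>+h. S xs b h \<partial>forward xs b m) \<partial>(\<Pi>\<^sub>M k\<in>{1..Suc m}. X))"
  proof (rule sum.cong[OF refl])
    fix b assume b: "b \<in> {1..Suc m} \<rightarrow>\<^sub>E {1..N}"
    have "(\<Sum>n=1..N. \<integral>\<^sup>+xs. ennreal (predictive m xs) *
        (\<integral>\<^sup>+h. step_functional \<Phi> m n xs b h \<partial>forward xs b m) \<partial>(\<Pi>\<^sub>M k\<in>{1..Suc m}. X)) =
      (\<integral>\<^sup>+xs. (\<Sum>n=1..N. ennreal (predictive m xs) *
        (\<integral>\<^sup>+h. step_functional \<Phi> m n xs b h \<partial>forward xs b m)) \<partial>(\<Pi>\<^sub>M k\<in>{1..Suc m}. X))"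
      using Suc.prems(1) by (intro nn_integral_sum[symmetric] measurable_forward_integral step_m b) auto
    also have "\<dots> = (\<integral>\<^sup>+xs. ennreal (predictive m xs) * (\<integral>\<^sup>+h. S xs b h \<partial>forward xs b m) \<partial>(\<Pi>\<^sub>M k\<in>{1..Suc m}. X))"
    proof (rule nn_integral_cong)
      fix xs assume xs: "xs \<in> space (\<Pi>\<^sub>M k\<in>{1..Suc m}. X)"
      have sets_F: "sets (forward xs b m) = sets (history_space X N m)"
        using prob_forward[OF _ xs b] Suc.prems(1) by (simp add: space_prob_algebra)
      have "(\<integral>\<^sup>+h. S xs b h \<partial>forward xs b m) = (\<Sum>n=1..N. \<integral>\<^sup>+h. step_functional \<Phi> m n xs b h \<partial>forward xs b m)"
        unfolding S_def
        using measurable_Pair2[OF step_m[OF b] xs] by (intro nn_integral_sum) (simp add: measurable_cong_sets[OF sets_F refl])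
      then show "(\<Sum>n=1..N. ennreal (predictive m xs) * (\<integral>\<^sup>+h. step_functional \<Phi> m n xs b h \<partial>forward xs b m)) =
          ennreal (predictive m xs) * (\<integral>\<^sup>+h. S xs b h \<partial>forward xs b m)"
        by (simp add: sum_distrib_left)
    qed
    finally show "(\<Sum>n=1..N. \<integral>\<^sup>+xs. ennreal (predictive m xs) *
        (\<integral>\<^sup>+h. step_functional \<Phi> m n xs b h \<partial>forward xs b m) \<partial>(\<Pi>\<^sub>M k\<in>{1..Suc m}. X)) = \<dots>" .
  qed
  also have "\<dots> = particle_integral m (\<lambda>h. \<Sum>j=1..N. S (lineage_path m h j) (lineage m h j) h)"
  proof (rule Suc.IH)
    fix b assume b: "b \<in> {1..Suc m} \<rightarrow>\<^sub>E {1..N}"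
    show "(\<lambda>(xs, h). S xs b h) \<in> borel_measurable ((\<Pi>\<^sub>M k\<in>{1..Suc m}. X) \<Otimes>\<^sub>M history_space X N m)"
      using step_m[OF b] unfolding S_def case_prod_beta by (intro borel_measurable_sum)
  qed (use Suc.prems(1) in simp)
  also have "\<dots> = particle_integral (Suc m) (\<lambda>h. \<Sum>j=1..N. \<Phi> (lineage_path (Suc m) h j) (lineage (Suc m) h j) h)"
    unfolding particle_integral.simps S_def
    using Suc.prems by (intro particle_integral_cong sum_step_functional) auto
  finally show ?case .
qed

end

section \<open>Reversibility\<close>

context particle_filter
begin

text \<open>Final selection and tracing as a kernel of the history alone: given the history, the
  output is independent of the input.\<close>

definition select_path ::
  "nat measure \<Rightarrow> nat \<Rightarrow> ((nat \<Rightarrow> nat \<Rightarrow> 'a) \<times> (nat \<Rightarrow> nat \<Rightarrow> nat)) \<Rightarrow> ((nat \<Rightarrow> 'a) \<times> (nat \<Rightarrow> nat)) measure" where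
  "select_path d m h = categorical N d (weights N G1 G (Suc m) (fst h) (snd h)) \<bind>
     (\<lambda>j. return (path_space X N (Suc m)) (lineage_path m h j, lineage m h j))"

lemma cpf_at_eq_select_path:
  "cpf_at X N (Suc m) M1 M G1 G rc rd d = (\<lambda>(xs, b). forward xs b m \<bind> select_path d m)"
  by (simp add: cpf_at_def select_path_def[abs_def] lineage_path_def lineage_def case_prod_beta' Let_def fun_eq_iff
      del: cpf_forward.simps)

lemma measurable_selected:
  "(\<lambda>(h, j). (lineage_path m h j, lineage m h j)) \<in> history_space X N m \<Otimes>\<^sub>M count_space {1..N} \<rightarrow>\<^sub>M path_space X N (Suc m)"
  unfolding case_prod_beta path_space_def
proof (rule measurable_compose_countable'[where f="\<lambda>j z. (lineage_path m (fst z) j, lineage m (fst z) j)" and g=snd and I="{1..N}"])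
  fix j assume j: "j \<in> {1..N}"
  show "(\<lambda>z. (lineage_path m (fst z) j, lineage m (fst z) j))
    \<in> history_space X N m \<Otimes>\<^sub>M count_space {1..N} \<rightarrow>\<^sub>M
      (\<Pi>\<^sub>M k\<in>{1..Suc m}. X) \<Otimes>\<^sub>M count_space ({1..Suc m} \<rightarrow>\<^sub>E {1..N})"
    by (rule measurable_Pair[OF measurable_lineage_path[OF measurable_fst j] measurable_lineage[OF measurable_fst j]])
qed auto

lemma measurable_select_path:
  assumes m: "Suc m \<le> T" and d: "d \<in> space (prob_algebra (count_space {1..N}))"
  shows "select_path d m \<in> history_space X N m \<rightarrow>\<^sub>M prob_algebra (path_space X N (Suc m))"
  unfolding select_path_def
proof (rule measurable_bind_prob_space2)
  show "(\<lambda>h. categorical N d (weights N G1 G (Suc m) (fst h) (snd h))) \<in> history_space X N m \<rightarrow>\<^sub>M prob_algebra (count_space {1..N})"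
    by (rule measurable_compose[OF measurable_weights[OF measurable_ident_sets[OF refl] m] measurable_categorical[OF d]])
  show "(\<lambda>(h, j). return (path_space X N (Suc m)) (lineage_path m h j, lineage m h j))
    \<in> history_space X N m \<Otimes>\<^sub>M count_space {1..N} \<rightarrow>\<^sub>M prob_algebra (path_space X N (Suc m))"
    using measurable_compose[OF measurable_selected measurable_return_prob_space] by (simp add: case_prod_beta)
qed

lemma emeasure_select_path:
  assumes m: "Suc m \<le> T" and d: "d \<in> space (prob_algebra (count_space {1..N}))"
    and h: "h \<in> space (history_space X N m)" and B: "B \<in> sets (path_space X N (Suc m))"
    and pos: "(\<Sum>i=1..N. weights N G1 G (Suc m) (fst h) (snd h) i) > 0"
  shows "emeasure (select_path d m h) B =
    (\<Sum>j=1..N. ennreal (weights N G1 G (Suc m) (fst h) (snd h) j / (\<Sum>i=1..N. weights N G1 G (Suc m) (fst h) (snd h) i)) *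
       indicator B (lineage_path m h j, lineage m h j))"
proof -
  let ?W = "weights N G1 G (Suc m) (fst h) (snd h)"
  have "(\<lambda>j. (lineage_path m h j, lineage m h j)) \<in> count_space {1..N} \<rightarrow>\<^sub>M path_space X N (Suc m)"
    using measurable_Pair2[OF measurable_selected h] by simp
  then have "(\<lambda>j. return (path_space X N (Suc m)) (lineage_path m h j, lineage m h j)) \<in> count_space {1..N} \<rightarrow>\<^sub>M prob_algebra (path_space X N (Suc m))"
    by (rule measurable_compose[OF _ measurable_return_prob_space])
  moreover have "categorical N d ?W \<in> space (prob_algebra (count_space {1..N}))"
    by (rule measurable_space[OF measurable_categorical[OF d] space_weights[OF h m]])
  ultimately have "emeasure (select_path d m h) B =
      (\<integral>\<^sup>+j. emeasure (return (path_space X N (Suc m)) (lineage_path m h j, lineage m h j)) B \<partial>categorical N d ?W)"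
    unfolding select_path_def using B by (intro emeasure_bind_prob_algebra)
  then show ?thesis
    using B by (simp add: nn_integral_categorical[OF pos])
qed

text \<open>Measurability for each fixed \<open>b\<close> is glued over the finite discrete set of
  index vectors.\<close>

lemma measurable_cpf_at:
  assumes m: "Suc m \<le> T" and d: "d \<in> space (prob_algebra (count_space {1..N}))"
  shows "cpf_at X N (Suc m) M1 M G1 G rc rd d \<in> path_space X N (Suc m) \<rightarrow>\<^sub>M prob_algebra (path_space X N (Suc m))"
  unfolding cpf_at_eq_select_path case_prod_beta path_space_def[of X N "Suc m"]
proof (rule measurable_compose_countable'[where f="\<lambda>b z. forward (fst z) b m \<bind> select_path d m" and g=snd and I="{1..Suc m} \<rightarrow>\<^sub>E {1..N}"])
  fix b assume "b \<in> {1..Suc m} \<rightarrow>\<^sub>E {1..N}"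
  then have "(\<lambda>z. forward (fst z) b m) \<in> (\<Pi>\<^sub>M k\<in>{1..Suc m}. X) \<Otimes>\<^sub>M count_space ({1..Suc m} \<rightarrow>\<^sub>E {1..N}) \<rightarrow>\<^sub>M prob_algebra (history_space X N m)"
    by (intro measurable_forward m measurable_path_component[OF measurable_fst]) auto
  then show "(\<lambda>z. forward (fst z) b m \<bind> select_path d m) \<in> (\<Pi>\<^sub>M k\<in>{1..Suc m}. X) \<Otimes>\<^sub>M count_space ({1..Suc m} \<rightarrow>\<^sub>E {1..N})
      \<rightarrow>\<^sub>M prob_algebra ((\<Pi>\<^sub>M k\<in>{1..Suc m}. X) \<Otimes>\<^sub>M count_space ({1..Suc m} \<rightarrow>\<^sub>E {1..N}))"
    by (rule measurable_bind_prob_space[OF _ measurable_select_path[OF m d, unfolded path_space_def]])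
qed (auto intro!: countable_finite finite_PiE)

text \<open>Reference lineage \<open>j\<close> and output lineage \<open>l\<close> jointly receive
  the product of their weights over the total weight. This is symmetric, so exchanging the two sums
  exchanges \<open>A\<close> and \<open>B\<close>.\<close>

lemma sum_selected_symmetric:
  assumes m: "Suc m \<le> T" and d: "d \<in> space (prob_algebra (count_space {1..N}))"
    and h: "h \<in> space (history_space X N m)"
    and A: "A \<in> sets (path_space X N (Suc m))" and B: "B \<in> sets (path_space X N (Suc m))"
  shows "(\<Sum>j=1..N. ennreal (potential (Suc m) (lineage_path m h j)) *
      indicator A (lineage_path m h j, lineage m h j) * emeasure (select_path d m h) B) =
    (\<Sum>j=1..N. ennreal (potential (Suc m) (lineage_path m h j)) *
      indicator B (lineage_path m h j, lineage m h j) * emeasure (select_path d m h) A)"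
proof -
  let ?W = "weights N G1 G (Suc m) (fst h) (snd h)"
  let ?z = "\<lambda>j. (lineage_path m h j, lineage m h j)"
  have W0: "0 \<le> ?W j" if "j \<in> {1..N}" for j
    using weight_space_nonneg[OF space_weights[OF h m] that] .
  have pot: "potential (Suc m) (lineage_path m h j) = ?W j" if "j \<in> {1..N}" for j
    by (rule weights_eq_potential_lineage[OF that, symmetric])
  show ?thesis
  proof (cases "(\<Sum>i=1..N. ?W i) > 0")
    \<comment> \<open>With zero total weight every potential is zero, which hides the arbitrary law
      \<open>d\<close> on both sides.\<close>
    case False
    then have "(\<Sum>i=1..N. ?W i) = 0"
      using sum_nonneg[of "{1..N}" ?W] W0 by fastforce
    then have "?W j = 0" if "j \<in> {1..N}" for j
      using sum_nonneg_eq_0_iff[of "{1..N}" ?W] W0 that by simp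
    then show ?thesis
      by (simp add: pot)
  next
    case True
    have expand: "(\<Sum>j=1..N. ennreal (potential (Suc m) (lineage_path m h j)) * indicator C (?z j) * emeasure (select_path d m h) C') =
      (\<Sum>j=1..N. \<Sum>l=1..N. ennreal (?W j * ?W l / (\<Sum>i=1..N. ?W i)) * (indicator C (?z j) * indicator C' (?z l)))"
      if "C' \<in> sets (path_space X N (Suc m))" for C C'
      unfolding emeasure_select_path[OF m d h that True] sum_distrib_left
    proof (intro sum.cong refl)
      fix j l assume j: "j \<in> {1..N}" and l: "l \<in> {1..N}"
      have "ennreal (?W j * ?W l / (\<Sum>i=1..N. ?W i)) = ennreal (?W j) * ennreal (?W l / (\<Sum>i=1..N. ?W i))"
        using W0[OF j] W0[OF l] True by (simp flip: ennreal_mult)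
      then show "ennreal (potential (Suc m) (lineage_path m h j)) * indicator C (?z j) *
          (ennreal (?W l / (\<Sum>i=1..N. ?W i)) * indicator C' (?z l)) =
        ennreal (?W j * ?W l / (\<Sum>i=1..N. ?W i)) * (indicator C (?z j) * indicator C' (?z l))"
        by (simp add: pot[OF j] mult_ac)
    qed
    show ?thesis
      unfolding expand[OF A] expand[OF B]
      by (subst sum.swap) (simp add: mult.commute)
  qed
qed

end

section \<open>Integration against the target law\<close>

context feynman_kac
begin

lemma fk_unnormalised_borel:
  "fk_unnormalised T M1 M G1 G \<in> borel_measurable (\<Pi>\<^sub>M k\<in>{1..T}. X)"
proof -
  obtain m where T: "T = Suc m" using T_ge_1 by (cases T) auto
  have "(\<lambda>x. predictive m x * potential (Suc m) x) \<in> borel_measurable (\<Pi>\<^sub>M k\<in>{1..T}. X)"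
    unfolding T by (intro borel_measurable_times predictive_borel potential_borel) (auto simp: T)
  then show ?thesis
    unfolding T fk_unnormalised_eq_predictive[abs_def] .
qed

lemma nn_integral_fk_distr:
  assumes "f \<in> borel_measurable (\<Pi>\<^sub>M k\<in>{1..T}. X)"
  shows "(\<integral>\<^sup>+x. f x \<partial>fk_distr X T M1 M G1 G) =
    inverse (fk_const X T M1 M G1 G) *
      (\<integral>\<^sup>+x. ennreal (fk_unnormalised T M1 M G1 G x) * f x \<partial>(\<Pi>\<^sub>M k\<in>{1..T}. X))"
proof -
  note [measurable] = fk_unnormalised_borel assms
  have "(\<integral>\<^sup>+x. f x \<partial>fk_distr X T M1 M G1 G) =
      (\<integral>\<^sup>+x. ennreal (fk_unnormalised T M1 M G1 G x) / fk_const X T M1 M G1 G * f x \<partial>(\<Pi>\<^sub>M k\<in>{1..T}. X))"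
    unfolding fk_distr_def by (rule nn_integral_density) measurable
  also have "\<dots> = (\<integral>\<^sup>+x. inverse (fk_const X T M1 M G1 G) *
      (ennreal (fk_unnormalised T M1 M G1 G x) * f x) \<partial>(\<Pi>\<^sub>M k\<in>{1..T}. X))"
    by (simp only: divide_ennreal_def mult_ac)
  also have "\<dots> = inverse (fk_const X T M1 M G1 G) *
      (\<integral>\<^sup>+x. ennreal (fk_unnormalised T M1 M G1 G x) * f x \<partial>(\<Pi>\<^sub>M k\<in>{1..T}. X))"
    by (rule nn_integral_cmult) measurable
  finally show ?thesis .
qed

lemma prob_space_fk_distr: "prob_space (fk_distr X T M1 M G1 G)"
proof
  have "emeasure (fk_distr X T M1 M G1 G) (space (fk_distr X T M1 M G1 G)) = (\<integral>\<^sup>+x. 1 \<partial>fk_distr X T M1 M G1 G)"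
    by simp
  also have "\<dots> = inverse (fk_const X T M1 M G1 G) * fk_const X T M1 M G1 G"
    by (subst nn_integral_fk_distr) (auto simp: fk_const_def)
  also have "\<dots> = 1"
    using const_pos const_finite ennreal_divide_self[of "fk_const X T M1 M G1 G"]
    by (simp add: divide_ennreal_def mult.commute)
  finally show "emeasure (fk_distr X T M1 M G1 G) (space (fk_distr X T M1 M G1 G)) = 1" .
qed

text \<open>Integrating the indices last turns their uniform law into a plain sum over
  \<open>b\<close>, the shape of the left side of \<open>forward_particle_integral\<close>.\<close>

lemma nn_integral_fk_uniform:
  assumes N: "N \<ge> 1" and f: "f \<in> borel_measurable (path_space X N T)"
  shows "(\<integral>\<^sup>+s. f s \<partial>(fk_distr X T M1 M G1 G \<Otimes>\<^sub>M uniform_count_measure ({1..T} \<rightarrow>\<^sub>E {1..N}))) =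
    ennreal (1 / card ({1..T} \<rightarrow>\<^sub>E {1..N})) * inverse (fk_const X T M1 M G1 G) *
    (\<Sum>b\<in>{1..T} \<rightarrow>\<^sub>E {1..N}. \<integral>\<^sup>+x. ennreal (fk_unnormalised T M1 M G1 G x) * f (x, b) \<partial>(\<Pi>\<^sub>M k\<in>{1..T}. X))"
proof -
  let ?I = "{1..T} \<rightarrow>\<^sub>E {1..N}"
  have fin: "finite ?I" by (intro finite_PiE) auto
  have ne: "?I \<noteq> {}" using N by (auto simp: PiE_eq_empty_iff)
  interpret P: prob_space "fk_distr X T M1 M G1 G" by (rule prob_space_fk_distr)
  interpret U: prob_space "uniform_count_measure ?I"
    using fin ne by (rule prob_space_uniform_count_measure)
  interpret pair_sigma_finite "fk_distr X T M1 M G1 G" "uniform_count_measure ?I" ..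
  have sets_P: "sets (fk_distr X T M1 M G1 G) = sets (\<Pi>\<^sub>M k\<in>{1..T}. X)" by (simp add: fk_distr_def)
  have "sets (fk_distr X T M1 M G1 G \<Otimes>\<^sub>M uniform_count_measure ?I) = sets (path_space X N T)"
    unfolding path_space_def by (intro sets_pair_measure_cong sets_P sets_uniform_count_measure_count_space)
  note sets_eq = this
  have f': "f \<in> borel_measurable (fk_distr X T M1 M G1 G \<Otimes>\<^sub>M uniform_count_measure ?I)"
    using f by (simp only: measurable_cong_sets[OF sets_eq refl])
  have fb: "(\<lambda>x. f (x, b)) \<in> borel_measurable (\<Pi>\<^sub>M k\<in>{1..T}. X)" if "b \<in> ?I" for b
    using f that unfolding path_space_def by (intro measurable_Pair1) auto
  have "(\<integral>\<^sup>+s. f s \<partial>(fk_distr X T M1 M G1 G \<Otimes>\<^sub>M uniform_count_measure ?I)) =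
      (\<integral>\<^sup>+b. \<integral>\<^sup>+x. f (x, b) \<partial>fk_distr X T M1 M G1 G \<partial>uniform_count_measure ?I)"
    by (rule nn_integral_snd[OF f', symmetric])
  also have "\<dots> = (\<Sum>b\<in>?I. ennreal (1 / card ?I) * (\<integral>\<^sup>+x. f (x, b) \<partial>fk_distr X T M1 M G1 G))"
    unfolding uniform_count_measure_def by (rule nn_integral_point_measure_finite[OF fin])
  also have "\<dots> = (\<Sum>b\<in>?I. ennreal (1 / card ?I) * inverse (fk_const X T M1 M G1 G) *
      (\<integral>\<^sup>+x. ennreal (fk_unnormalised T M1 M G1 G x) * f (x, b) \<partial>(\<Pi>\<^sub>M k\<in>{1..T}. X)))"
    by (intro sum.cong refl) (simp add: nn_integral_fk_distr[OF fb] mult.assoc)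
  finally show ?thesis
    by (simp add: sum_distrib_left)
qed

end

section \<open>Symmetry of the stationary flow\<close>

context particle_filter
begin

text \<open>The stationary probability of moving from \<open>A\<close> to \<open>B\<close>, with the
  input replaced by a lineage of the history. Both normalising constants stand outside, so
  \<open>A\<close> and \<open>B\<close> enter only through the integrand.\<close>

lemma cpf_at_flow:
  assumes T: "T = Suc m" and N: "N \<ge> 1" and d: "d \<in> space (prob_algebra (count_space {1..N}))"
    and A: "A \<in> sets (path_space X N T)" and B: "B \<in> sets (path_space X N T)"
  shows "(\<integral>\<^sup>+s\<in>A. emeasure (cpf_at X N T M1 M G1 G rc rd d s) B
      \<partial>(fk_distr X T M1 M G1 G \<Otimes>\<^sub>M uniform_count_measure ({1..T} \<rightarrow>\<^sub>E {1..N}))) =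
    ennreal (1 / card ({1..T} \<rightarrow>\<^sub>E {1..N})) * inverse (fk_const X T M1 M G1 G) *
    particle_integral m (\<lambda>h. \<Sum>j=1..N. ennreal (potential T (lineage_path m h j)) *
      indicator A (lineage_path m h j, lineage m h j) * emeasure (select_path d m h) B)"
proof -
  have m: "Suc m \<le> T" using T by simp
  let ?I = "{1..Suc m} \<rightarrow>\<^sub>E {1..N}"
  \<comment> \<open>\<open>forward_particle_integral\<close> integrates against the density without
    its final potential, so that factor goes into \<open>\<Phi>\<close>.\<close>
  define \<Phi> where "\<Phi> xs b h = ennreal (potential (Suc m) xs) * indicator A (xs, b) * emeasure (select_path d m h) B"
    for xs b h
  have O: "select_path d m \<in> history_space X N m \<rightarrow>\<^sub>M prob_algebra (path_space X N (Suc m))"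
    by (rule measurable_select_path[OF m d])
  have O_B: "(\<lambda>h. emeasure (select_path d m h) B) \<in> borel_measurable (history_space X N m)"
    using B unfolding T by (rule measurable_emeasure_kernel[OF measurable_prob_algebraD[OF O]])
  have A_b: "(\<lambda>xs. indicator A (xs, b) :: ennreal) \<in> borel_measurable (\<Pi>\<^sub>M k\<in>{1..Suc m}. X)" if "b \<in> ?I" for b
  proof -
    have "indicator A \<in> borel_measurable ((\<Pi>\<^sub>M k\<in>{1..Suc m}. X) \<Otimes>\<^sub>M count_space ?I)"
      using A unfolding T path_space_def by (rule borel_measurable_indicator)
    then show ?thesis using that by (intro measurable_Pair1) auto
  qed
  have \<Phi>_m: "(\<lambda>(xs, h). \<Phi> xs b h) \<in> borel_measurable ((\<Pi>\<^sub>M k\<in>{1..Suc m}. X) \<Otimes>\<^sub>M history_space X N m)"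
    if "b \<in> ?I" for b
    unfolding \<Phi>_def case_prod_beta
    by (intro borel_measurable_times_ennreal measurable_compose[OF measurable_fst A_b[OF that]] measurable_compose[OF measurable_snd O_B]
        measurable_compose[OF potential_borel measurable_ennreal] measurable_path_component[OF measurable_fst])
       (use m in auto)
  have K: "(\<lambda>s. emeasure (cpf_at X N T M1 M G1 G rc rd d s) B) \<in> borel_measurable (path_space X N T)"
    using measurable_emeasure_kernel[OF measurable_prob_algebraD[OF measurable_cpf_at[OF m d]] B[unfolded T]] T by simp
  have "(\<integral>\<^sup>+s\<in>A. emeasure (cpf_at X N T M1 M G1 G rc rd d s) B
      \<partial>(fk_distr X T M1 M G1 G \<Otimes>\<^sub>M uniform_count_measure ({1..T} \<rightarrow>\<^sub>E {1..N}))) =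
    ennreal (1 / card ({1..T} \<rightarrow>\<^sub>E {1..N})) * inverse (fk_const X T M1 M G1 G) *
    (\<Sum>b\<in>{1..T} \<rightarrow>\<^sub>E {1..N}. \<integral>\<^sup>+x. ennreal (fk_unnormalised T M1 M G1 G x) *
      (emeasure (cpf_at X N T M1 M G1 G rc rd d (x, b)) B * indicator A (x, b)) \<partial>(\<Pi>\<^sub>M k\<in>{1..T}. X))"
    by (intro nn_integral_fk_uniform[OF N] borel_measurable_times_ennreal K borel_measurable_indicator A)
  also have "(\<Sum>b\<in>{1..T} \<rightarrow>\<^sub>E {1..N}. \<integral>\<^sup>+x. ennreal (fk_unnormalised T M1 M G1 G x) *
      (emeasure (cpf_at X N T M1 M G1 G rc rd d (x, b)) B * indicator A (x, b)) \<partial>(\<Pi>\<^sub>M k\<in>{1..T}. X)) =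
    (\<Sum>b\<in>?I. \<integral>\<^sup>+xs. ennreal (predictive m xs) * (\<integral>\<^sup>+h. \<Phi> xs b h \<partial>forward xs b m) \<partial>(\<Pi>\<^sub>M k\<in>{1..Suc m}. X))"
    unfolding T
  proof (intro sum.cong refl nn_integral_cong)
    fix b xs assume b: "b \<in> ?I" and xs: "xs \<in> space (\<Pi>\<^sub>M k\<in>{1..Suc m}. X)"
    have F: "forward xs b m \<in> space (prob_algebra (history_space X N m))"
      by (rule prob_forward[OF m xs b])
    then have sets_F: "sets (forward xs b m) = sets (history_space X N m)"
      by (simp add: space_prob_algebra)
    have "emeasure (cpf_at X N (Suc m) M1 M G1 G rc rd d (xs, b)) B = (\<integral>\<^sup>+h. emeasure (select_path d m h) B \<partial>forward xs b m)"
      unfolding cpf_at_eq_select_path using emeasure_bind_prob_algebra[OF F O B[unfolded T]] by simp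
    moreover have "(\<integral>\<^sup>+h. \<Phi> xs b h \<partial>forward xs b m) =
        ennreal (potential (Suc m) xs) * indicator A (xs, b) * (\<integral>\<^sup>+h. emeasure (select_path d m h) B \<partial>forward xs b m)"
      unfolding \<Phi>_def using O_B by (intro nn_integral_cmult) (simp add: measurable_cong_sets[OF sets_F refl])
    moreover have "ennreal (fk_unnormalised (Suc m) M1 M G1 G xs) = ennreal (predictive m xs) * ennreal (potential (Suc m) xs)"
      unfolding fk_unnormalised_eq_predictive
      using xs m by (intro ennreal_mult predictive_nonneg potential_nonneg) (auto simp: space_PiM)
    ultimately show "ennreal (fk_unnormalised (Suc m) M1 M G1 G xs) *
        (emeasure (cpf_at X N (Suc m) M1 M G1 G rc rd d (xs, b)) B * indicator A (xs, b)) =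
      ennreal (predictive m xs) * (\<integral>\<^sup>+h. \<Phi> xs b h \<partial>forward xs b m)"
      by (simp only: mult_ac)
  qed
  also have "\<dots> = particle_integral m (\<lambda>h. \<Sum>j=1..N. \<Phi> (lineage_path m h j) (lineage m h j) h)"
    by (rule forward_particle_integral[OF m \<Phi>_m])
  finally show ?thesis
    unfolding \<Phi>_def T .
qed

text \<open>By \<open>cpf_at_flow\<close> the two flows differ only in the integrand of
  \<open>particle_integral\<close>, and \<open>sum_selected_symmetric\<close> equates the integrands
  history by history.\<close>

lemma reversible_cpf_at:
  assumes N: "N \<ge> 1" and d: "d \<in> space (prob_algebra (count_space {1..N}))"
  shows "reversible_kernel (fk_distr X T M1 M G1 G \<Otimes>\<^sub>M uniform_count_measure ({1..T} \<rightarrow>\<^sub>E {1..N}))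
    (cpf_at X N T M1 M G1 G rc rd d)"
proof -
  obtain m where T: "T = Suc m" using T_ge_1 by (cases T) auto
  then have m: "Suc m \<le> T" by simp
  let ?\<mu> = "fk_distr X T M1 M G1 G \<Otimes>\<^sub>M uniform_count_measure ({1..T} \<rightarrow>\<^sub>E {1..N})"
  have "sets (fk_distr X T M1 M G1 G) = sets (\<Pi>\<^sub>M k\<in>{1..T}. X)" by (simp add: fk_distr_def)
  then have sets_\<mu>: "sets ?\<mu> = sets (path_space X N T)"
    unfolding path_space_def by (intro sets_pair_measure_cong sets_uniform_count_measure_count_space)
  \<comment> \<open>\<open>prob_algebra\<close> sees only the sigma-algebra, so the target law may
    be exchanged for \<open>path_space\<close> in the kernel type.\<close>
  have "prob_algebra ?\<mu> = prob_algebra (path_space X N T)"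
    by (simp only: prob_algebra_def subprob_algebra_cong[OF sets_\<mu>])
  then have "cpf_at X N T M1 M G1 G rc rd d \<in> ?\<mu> \<rightarrow>\<^sub>M prob_algebra ?\<mu>"
    using measurable_cpf_at[OF m d] unfolding T[symmetric]
    by (simp only: measurable_cong_sets[OF sets_\<mu> refl])
  moreover have "(\<integral>\<^sup>+s\<in>A. emeasure (cpf_at X N T M1 M G1 G rc rd d s) B \<partial>?\<mu>) =
      (\<integral>\<^sup>+s\<in>B. emeasure (cpf_at X N T M1 M G1 G rc rd d s) A \<partial>?\<mu>)" if "A \<in> sets ?\<mu>" "B \<in> sets ?\<mu>" for A B
  proof -
    have A: "A \<in> sets (path_space X N T)" and B: "B \<in> sets (path_space X N T)"
      using that sets_\<mu> by auto
    have "particle_integral m (\<lambda>h. \<Sum>j=1..N. ennreal (potential T (lineage_path m h j)) *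
        indicator A (lineage_path m h j, lineage m h j) * emeasure (select_path d m h) B) =
      particle_integral m (\<lambda>h. \<Sum>j=1..N. ennreal (potential T (lineage_path m h j)) *
        indicator B (lineage_path m h j, lineage m h j) * emeasure (select_path d m h) A)"
      using A B unfolding T by (intro particle_integral_cong m sum_selected_symmetric d)
    then show ?thesis
      unfolding cpf_at_flow[OF T N d A B] cpf_at_flow[OF T N d B A] by simp
  qed
  ultimately show ?thesis
    unfolding reversible_kernel_def by blast
qed

end

theorem theorem2:
  fixes X :: "'a measure" and N T :: nat
    and M1 :: "'a \<Rightarrow> real" and M :: "nat \<Rightarrow> 'a \<Rightarrow> 'a \<Rightarrow> real"
    and G1 :: "'a \<Rightarrow> real" and G :: "nat \<Rightarrow> 'a \<Rightarrow> 'a \<Rightarrow> real"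
    and rc rd :: "nat \<Rightarrow> nat \<Rightarrow> (nat \<Rightarrow> real) \<Rightarrow> (nat \<Rightarrow> nat) measure"
    and d :: "nat measure"
  assumes "N \<ge> 1" and "T \<ge> 1"
    and "feynman_kac X T M1 M G1 G"
    and "valid_conditional_resampling N rc"
    and "\<And>p n. p \<in> {1..N} \<Longrightarrow> n \<in> {1..N} \<Longrightarrow> resampling_scheme N (rd p n)"
    and "d \<in> space (prob_algebra (count_space {1..N}))"
  shows "reversible_kernel
           (fk_distr X T M1 M G1 G \<Otimes>\<^sub>M uniform_count_measure ({1..T} \<rightarrow>\<^sub>E {1..N}))
           (cpf_at X N T M1 M G1 G rc rd d)"
proof -
  from assms(4) obtain r
    where rc: "\<forall>p\<in>{1..N}. \<forall>n\<in>{1..N}. resampling_scheme N (rc p n)"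
      and r: "resampling_scheme N r"
      and valid: "\<forall>g\<in>space (weight_space N). (\<Sum>l=1..N. g l) > 0 \<longrightarrow>
        (\<forall>p\<in>{1..N}. \<forall>n\<in>{1..N}.
          \<P>(A in rc p n g. A n = p) = 1 \<and>
          (g p > 0 \<longrightarrow> (\<forall>a\<in>{1..N} \<rightarrow>\<^sub>E {1..N}. a n = p \<longrightarrow>
            measure (rc p n g) {a} = \<P>(A in r g. (\<forall>i\<in>{1..N} - {n}. A i = a i) \<bar> A n = p))) \<and>
          \<P>(A in r g. A n = p) = g p / (\<Sum>i=1..N. g i))"
    unfolding valid_conditional_resampling_def by (elim conjE exE) (rule that)
  interpret feynman_kac X T M1 M G1 G by fact
  interpret particle_filter X T M1 M G1 G N rc rd r
    by unfold_locales (use rc r assms(5) valid in blast)+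
  show ?thesis
    using assms(1,6) by (rule reversible_cpf_at)
qed

end
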